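(* Let $j,k\in\mathbb{Z}$, let $\tau\in\mathbb{H}$ be in the upper half plane, and put $q=e^{2\pi\sqrt{-1}\,\tau}$. Then $$\begin{aligned} &(2\pi \sqrt{-1})^4\sum_{a,b,c,d\in\mathbb{Z}}\frac{2(1+q^{jc+kd})}{(1+q^a)(1+q^b)(1+q^{c})(1+q^{d})(1+q^{jc+kd-a-b})(1+q^{-c-d})}\\ =\ &\Big(\frac{3\theta''(\frac12,\tau)}{2\theta(\frac12,\tau)}-\frac{\theta^{(3)}(0,\tau)}{2\theta'(0,\tau)}\Big)^2+(j^2+k^2-jk)\Big(\frac{\theta''(\frac12,\tau)^2}{4\theta(\frac12,\tau)^2}+\frac{5\theta^{(4)}(\frac12,\tau)}{24\theta(\frac12,\tau)}\\ &\quad-\frac{7\theta^{(3)}(0,\tau)\theta''(\frac12,\tau)}{12\theta'(0,\tau)\theta(\frac12,\tau)}-\frac{\theta^{(5)}(0,\tau)}{24\theta'(0,\tau)}+\frac{\theta^{(3)}(0,\tau)^2}{6\theta'(0,\tau)^2}\Big). \end{aligned}$$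
   Context: The Jacobi theta function is $$\theta(z,\tau)=2q^{1/8}\sin(\pi z)\prod_{m=1}^\infty\big[(1-q^m)(1-e^{2\pi \sqrt{-1}\, z}q^m)(1-e^{-2\pi \sqrt{-1}\, z}q^m)\big],\qquad q=e^{2\pi\sqrt{-1}\,\tau},\ q^{1/8}=e^{2\pi\sqrt{-1}\,\tau/8}.$$ Primes and superscripts ${}^{(m)}$ denote derivatives with respect to $z$. *)

theory Defs
  imports "HOL-Complex_Analysis.Complex_Analysis"
begin

definition q_param :: "complex \<Rightarrow> complex" where
  "q_param \<tau> = exp (2 * of_real pi * \<i> * \<tau>)"

text \<open>
  The prefactor \<open>q\<^sup>1\<^sup>/\<^sup>8\<close> is \<open>exp (2 \<pi> \<i> \<tau> / 8)\<close>, so it depends on \<open>\<tau>\<close>, not just on \<open>q\<close>.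
\<close>

definition jacobi_theta :: "complex \<Rightarrow> complex \<Rightarrow> complex" where
  "jacobi_theta z \<tau> =
     2 * exp (2 * of_real pi * \<i> * \<tau> / 8) * sin (of_real pi * z) *
     (\<Prod>m. (1 - q_param \<tau> ^ Suc m) *
           (1 - exp (2 * of_real pi * \<i> * z) * q_param \<tau> ^ Suc m) *
           (1 - exp (- (2 * of_real pi * \<i> * z)) * q_param \<tau> ^ Suc m))"

definition jacobi_theta_deriv :: "nat \<Rightarrow> complex \<Rightarrow> complex \<Rightarrow> complex" where
  "jacobi_theta_deriv n z \<tau> = (deriv ^^ n) (\<lambda>w. jacobi_theta w \<tau>) z"

definition theta_summand :: "int \<Rightarrow> int \<Rightarrow> complex \<Rightarrow> int \<times> int \<times> int \<times> int \<Rightarrow> complex" where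
  "theta_summand j k q = (\<lambda>(a, b, c, d).
     2 * (1 + q powi (j * c + k * d)) /
     ((1 + q powi a) * (1 + q powi b) * (1 + q powi c) * (1 + q powi d) *
      (1 + q powi (j * c + k * d - a - b)) * (1 + q powi (- c - d))))"

end

theory Submission
  imports Defs
begin

text \<open>
  Write \<open>f n = 1 / (1 + q\<^sup>n)\<close> and \<open>g n = 1 / (1 - q\<^sup>n)\<close>. Partial fractions make the inner sums telescope:
  \<open>\<Sum>a. f a f (m - a) = m g m\<close> for \<open>m \<noteq> 0\<close>, and then, with \<open>\<beta> = \<Sum>a. f a f (-a)\<close> and
  \<open>\<gamma> = \<Sum>m. m (g m - f m)\<close>,
  \<open>(1 + q\<^sup>n) (\<Sum>a b. f a f b f (n - a - b)) = \<beta> + \<gamma> + n\<^sup>2 / 2\<close>.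
  Putting \<open>n = j c + k d\<close> and using the symmetry of \<open>f c f d f (-c-d)\<close>, the fourfold sum becomes
  \<open>(\<beta> + \<gamma>)\<^sup>2 + (j\<^sup>2 + k\<^sup>2 - j k) E\<close> with \<open>E = \<Sum>c. c\<^sup>3 q\<^sup>c / (1 - q\<^bsup>2c\<^esup>)\<close>.
  On the other side, logarithmic differentiation of the product expresses the theta quotients by Lambert
  series. The two sides then agree up to one quadratic relation between Lambert series, which again
  follows from partial fractions: square \<open>\<Sum>n. x\<^sub>n / (1 - x\<^sub>n)\<^sup>2\<close> for \<open>x\<^sub>n = \<plusminus>q\<^sup>n\<close> and sum along the
  diagonals.
\<close>

section \<open>Sums over the integers\<close>

text \<open>The case n = 0 of the inner double sum already evaluates the sum of
  \<open>f c * f d * f (- c - d)\<close> to half of \<beta> + \<gamma>; this is why the constant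
  part of the fourfold sum is a perfect square. The kernel tends to 0 on one side and to 1 on the
  other. Hence telescoping over the integers does not give 0 but a boundary term, k, or k^2/2 with
  the weight n, and every rearrangement needs absolute convergence. It is shown once for the whole
  fourfold family; summability over (m, a) and over (c, d) is then inherited from it. The partial
  fractions break down at the pole of g. The exceptional diagonals are not a nuisance only: they
  supply \<beta> and, in the quadratic relation, the sums of squares. On the theta side, 0 and 1/2
  are points where exp(2 pi i z) is its own inverse, so at each of them the even-order derivatives
  of the logarithmic derivative of the product vanish and two Lambert series carry all that is
  needed. The quadratic relation is unavoidable: the bracket in the theorem contains squares of
  weight 2 series, whereas \<open>E\<close> is linear in a weight 4 series.\<close>

lemma tendsto_power_geometric_0:
  fixes r :: real
  assumes "0 \<le> r" "r < 1"
  shows "(\<lambda>n. real n ^ k * r ^ n) \<longlonglongrightarrow> 0"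
  using assms
proof (induction k arbitrary: r)
  case 0
  then show ?case by (simp add: LIMSEQ_power_zero)
next
  case (Suc k)
  \<comment> \<open>One factor \<open>sqrt r ^ n\<close> absorbs the first k powers of n, the other
    the remaining one; hence the induction runs over all r at once.\<close>
  have "(\<lambda>n. (real n ^ k * sqrt r ^ n) * (real n * sqrt r ^ n)) \<longlonglongrightarrow> 0 * 0"
    using Suc.prems by (intro tendsto_mult Suc.IH powser_times_n_limit_0) auto
  also have "(\<lambda>n. (real n ^ k * sqrt r ^ n) * (real n * sqrt r ^ n)) = (\<lambda>n. real n ^ Suc k * (sqrt r * sqrt r) ^ n)"
    by (simp add: power_mult_distrib mult_ac del: real_sqrt_mult_self)
  finally show ?case using Suc.prems by simp
qed

lemma summable_power_geometric:
  fixes r :: real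
  assumes "0 \<le> r" "r < 1"
  shows "summable (\<lambda>n. real n ^ k * r ^ n)"
proof (rule summable_comparison_test_ev)
  show "summable (\<lambda>n. sqrt r ^ n)" using assms by (intro summable_geometric) simp
  have "\<forall>\<^sub>F n in sequentially. real n ^ k * sqrt r ^ n < 1"
    using tendsto_power_geometric_0[of "sqrt r" k] assms by (intro order_tendstoD(2)[where y = 0]) auto
  then show "\<forall>\<^sub>F n in sequentially. norm (real n ^ k * r ^ n) \<le> sqrt r ^ n"
  proof eventually_elim
    case (elim n)
    have "real n ^ k * r ^ n = (real n ^ k * sqrt r ^ n) * sqrt r ^ n"
      using assms by (simp flip: power_mult_distrib)
    also have "\<dots> \<le> 1 * sqrt r ^ n" using elim assms by (intro mult_right_mono) auto
    finally show ?case using assms by simp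
  qed
qed

lemma summable_on_int_power_geometric:
  fixes r :: real
  assumes "0 \<le> r" "r < 1"
  shows "(\<lambda>n::int. \<bar>real_of_int n\<bar> ^ k * r ^ nat \<bar>n\<bar>) summable_on UNIV"
proof -
  let ?u = "\<lambda>n::int. \<bar>real_of_int n\<bar> ^ k * r ^ nat \<bar>n\<bar>"
  from summable_power_geometric[OF assms]
  have nat: "(\<lambda>n. real n ^ k * r ^ n) summable_on UNIV"
    by (rule summable_nonneg_imp_summable_on) (use assms in auto)
  have "?u summable_on range int"
    by (subst summable_on_reindex) (use nat in \<open>auto simp: o_def\<close>)
  moreover have "?u summable_on range (\<lambda>n. - int n)"
    by (subst summable_on_reindex) (use nat in \<open>auto simp: o_def inj_on_def\<close>)
  moreover have "range int \<union> range (\<lambda>n. - int n) = UNIV"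
  proof -
    have "n \<in> range int \<union> range (\<lambda>n. - int n)" for n :: int
      by (cases n rule: int_cases2) auto
    then show ?thesis by blast
  qed
  ultimately show ?thesis
    using summable_on_union[of ?u "range int" "range (\<lambda>n. - int n)"] by simp
qed

lemma summable_on_int_geometric_bound:
  fixes u :: "int \<Rightarrow> complex"
  assumes "0 \<le> r" "r < 1" "\<And>n. norm (u n) \<le> K * (\<bar>real_of_int n\<bar> ^ k * r ^ nat \<bar>n\<bar>)"
  shows "(\<lambda>n. norm (u n)) summable_on UNIV"
  by (rule Infinite_Sum.abs_summable_on_comparison_test'[where g = "\<lambda>n. K * (\<bar>real_of_int n\<bar> ^ k * r ^ nat \<bar>n\<bar>)"])
    (use assms in \<open>auto intro!: summable_on_cmult_right summable_on_int_power_geometric\<close>)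

lemma has_sum_diff:
  fixes u v :: "'b \<Rightarrow> 'a :: real_normed_vector"
  assumes "(u has_sum a) A" "(v has_sum b) A"
  shows "((\<lambda>x. u x - v x) has_sum (a - b)) A"
  using has_sum_add[OF assms(1), of "\<lambda>x. - v x" "- b"] assms(2) by (simp add: has_sum_uminus)

lemma has_sum_int_shift:
  fixes u :: "int \<Rightarrow> 'a :: {comm_monoid_add, topological_space}"
  shows "((\<lambda>n. u (n + k)) has_sum c) UNIV \<longleftrightarrow> (u has_sum c) UNIV"
  by (rule has_sum_reindex_bij_witness[where i = "\<lambda>n. n - k" and j = "\<lambda>n. n + k"]) auto

lemma has_sum_int_reflect:
  fixes u :: "int \<Rightarrow> 'a :: {comm_monoid_add, topological_space}"
  shows "((\<lambda>n. u (k - n)) has_sum c) UNIV \<longleftrightarrow> (u has_sum c) UNIV"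
  by (rule has_sum_reindex_bij_witness[where i = "\<lambda>n. k - n" and j = "\<lambda>n. k - n"]) auto

text \<open>Folding at 0 links the sums over the integers, where telescoping works, to the one-sided
  series that the theta product yields.\<close>

lemma infsum_even_int:
  fixes u :: "int \<Rightarrow> complex"
  assumes "(\<lambda>n. norm (u n)) summable_on UNIV" "\<And>n. u (- n) = u n"
  shows "(u has_sum (u 0 + 2 * (\<Sum>i. u (int (Suc i))))) UNIV"
    and "summable (\<lambda>i. norm (u (int (Suc i))))"
proof -
  let ?P = "range (\<lambda>i. int (Suc i))" and ?N = "range (\<lambda>i. - int (Suc i))"
  have "(\<lambda>n. norm (u n)) summable_on ?P"
    using assms(1) by (rule summable_on_subset_banach) auto
  then have 1: "(\<lambda>i. norm (u (int (Suc i)))) summable_on UNIV"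
    by (subst (asm) summable_on_reindex) (auto simp: o_def inj_on_def)
  then show s: "summable (\<lambda>i. norm (u (int (Suc i))))"
    by (rule summable_on_imp_summable)
  have 2: "((\<lambda>i. u (int (Suc i))) has_sum (\<Sum>i. u (int (Suc i)))) UNIV"
    by (rule norm_summable_imp_has_sum[OF s summable_sums[OF summable_norm_cancel[OF s]]])
  have p: "(u has_sum (\<Sum>i. u (int (Suc i)))) ?P"
  proof (subst has_sum_reindex)
    show "((u \<circ> (\<lambda>i. int (Suc i))) has_sum (\<Sum>i. u (int (Suc i)))) UNIV"
      using 2 by (simp only: o_def)
  qed (simp add: inj_on_def)
  have n: "(u has_sum (\<Sum>i. u (int (Suc i)))) ?N"
  proof (subst has_sum_reindex)
    show "((u \<circ> (\<lambda>i. - int (Suc i))) has_sum (\<Sum>i. u (int (Suc i)))) UNIV"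
      using 2 by (simp only: o_def assms(2))
  qed (simp add: inj_on_def)
  have "(u has_sum (\<Sum>i. u (int (Suc i))) + (\<Sum>i. u (int (Suc i)))) (?P \<union> ?N)"
    by (rule has_sum_Un_disjoint[OF p n]) auto
  then have *: "(u has_sum (u 0 + ((\<Sum>i. u (int (Suc i))) + (\<Sum>i. u (int (Suc i)))))) (insert 0 (?P \<union> ?N))"
    by (intro has_sum_insert) auto
  have **: "insert 0 (?P \<union> ?N) = UNIV"
  proof -
    have "n \<in> insert 0 (?P \<union> ?N)" for n :: int
      proof (cases n rule: int_cases3)
      case (pos m)
      then have "n = int (Suc (m - 1))" by simp
      then show ?thesis by blast
    next
      case (neg m)
      then have "n = - int (Suc (m - 1))" by simp
      then show ?thesis by blast
    qed simp
    then show ?thesis by blast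
  qed
  show "(u has_sum (u 0 + 2 * (\<Sum>i. u (int (Suc i))))) UNIV"
    using * unfolding ** mult_2 .
qed

text \<open>Subtracting the Heaviside step leaves a summable function, whose sum over \<int> is
  translation invariant; only the step contributes.\<close>

lemma has_sum_int_telescope:
  fixes \<phi> :: "int \<Rightarrow> complex"
  assumes "(\<lambda>n. \<phi> n - (if n > 0 then 1 else 0)) summable_on UNIV"
  shows "((\<lambda>n. \<phi> n - \<phi> (n - k)) has_sum of_int k) UNIV"
proof -
  define H where "H = (\<lambda>n::int. if n > 0 then 1 else 0 :: complex)"
  define \<psi> where "\<psi> = (\<lambda>n. \<phi> n - H n)"
  obtain c where c: "(\<psi> has_sum c) UNIV"
    using assms unfolding \<psi>_def H_def summable_on_def by blast
  have 1: "((\<lambda>n. H n - H (n - k)) has_sum of_int k) UNIV"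
  proof (cases "k \<ge> 0")
    case True
    have "((\<lambda>n. H n - H (n - k)) has_sum (\<Sum>n\<in>{1..k}. 1)) UNIV"
      by (rule has_sum_finite_neutralI[where B = "{1..k}"]) (use True in \<open>auto simp: H_def\<close>)
    then show ?thesis using True by simp
  next
    case False
    have "((\<lambda>n. H n - H (n - k)) has_sum (\<Sum>n\<in>{k+1..0}. -1)) UNIV"
      by (rule has_sum_finite_neutralI[where B = "{k+1..0}"]) (use False in \<open>auto simp: H_def\<close>)
    then show ?thesis using False by simp
  qed
  have 2: "((\<lambda>n. \<psi> n - \<psi> (n - k)) has_sum (c - c)) UNIV"
    using has_sum_diff[OF c, of "\<lambda>n. \<psi> (n - k)" c] has_sum_int_shift[of \<psi> "-k" c] c by simp
  have "(\<lambda>n. (\<psi> n - \<psi> (n - k)) + (H n - H (n - k))) = (\<lambda>n. \<phi> n - \<phi> (n - k))"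
    by (simp add: \<psi>_def)
  with has_sum_add[OF 2 1] show ?thesis by simp
qed

text \<open>With H the step and \<psi> = \<phi> - H, the term n (\<psi> n - \<psi> (n - k)) is a
  translation difference of n \<psi> n minus k \<psi> (n - k). The step contributes k (k + 1) / 2,
  and the symmetry forces the sum of \<psi> to be 1/2, which removes k/2.\<close>

lemma has_sum_int_telescope_moment:
  fixes \<phi> :: "int \<Rightarrow> complex"
  assumes "(\<lambda>n. \<phi> n - (if n > 0 then 1 else 0)) summable_on UNIV"
    and "(\<lambda>n. of_int n * (\<phi> n - (if n > 0 then 1 else 0))) summable_on UNIV"
    and sym: "\<And>n. \<phi> n + \<phi> (- n) = 1"
  shows "((\<lambda>n. of_int n * (\<phi> n - \<phi> (n - k))) has_sum (of_int k)\<^sup>2 / 2) UNIV"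
proof -
  define H where "H = (\<lambda>n::int. if n > 0 then 1 else 0 :: complex)"
  define \<psi> where "\<psi> = (\<lambda>n. \<phi> n - H n)"
  obtain c where c: "(\<psi> has_sum c) UNIV"
    using assms unfolding \<psi>_def H_def summable_on_def by blast
  obtain d where d: "((\<lambda>n. of_int n * \<psi> n) has_sum d) UNIV"
    using assms unfolding \<psi>_def H_def summable_on_def by blast
  have "((\<lambda>n. \<psi> n + \<psi> (-n)) has_sum (c + c)) UNIV"
    using has_sum_add[OF c, of "\<lambda>n. \<psi> (- n)" c] has_sum_int_reflect[of \<psi> 0 c] c by simp
  \<comment> \<open>The step breaks the symmetry only at n = 0, where \<open>H 0 + H 0\<close> is 0
    instead of 1. This single defect determines the sum of \<psi>.\<close>
  moreover have "\<psi> n + \<psi> (-n) = (if n = 0 then 1 else 0)" for n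
  proof -
    have "\<psi> n + \<psi> (-n) = \<phi> n + \<phi> (-n) - (H n + H (-n))" by (simp add: \<psi>_def)
    then show ?thesis unfolding sym by (auto simp: H_def)
  qed
  then have "((\<lambda>n. \<psi> n + \<psi> (-n)) has_sum (\<Sum>n\<in>{0::int}. 1)) UNIV"
    by (intro has_sum_finite_neutralI[where B = "{0}"]) (simp_all only:, auto)
  ultimately have "c + c = (\<Sum>n\<in>{0::int}. 1)" by (rule has_sum_unique)
  then have c2: "c + c = 1" by simp
  have gauss: "(\<Sum>n\<in>{1..int m}. of_int n) = (of_nat m * (of_nat m + 1) / 2 :: complex)" for m
  proof (induction m)
    case (Suc m)
    have "(\<Sum>n\<in>{1..int (Suc m)}. of_int n) = (\<Sum>n\<in>insert (int (Suc m)) {1..int m}. of_int n :: complex)"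
      by (rule arg_cong[where f = "sum of_int"]) auto
    also have "\<dots> = of_nat (Suc m) + (of_nat m * (of_nat m + 1) / 2)"
      by (subst sum.insert) (simp_all only: Suc.IH, auto)
    finally show ?case by (simp add: field_simps)
  qed simp
  have gauss': "(\<Sum>n\<in>{1..m}. of_int n) = (of_int m * (of_int m + 1) / 2 :: complex)" if "m \<ge> 0" for m
    using gauss[of "nat m"] that by simp
  have 1: "((\<lambda>n. of_int n * (H n - H (n - k))) has_sum of_int k * (of_int k + 1) / 2) UNIV"
  proof (cases "k \<ge> 0")
    case True
    have "((\<lambda>n. of_int n * (H n - H (n - k))) has_sum (\<Sum>n\<in>{1..k}. of_int n)) UNIV"
      by (rule has_sum_finite_neutralI[where B = "{1..k}"]) (use True in \<open>auto simp: H_def\<close>)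
    then show ?thesis using True gauss' by simp
  next
    case False
    have "((\<lambda>n. of_int n * (H n - H (n - k))) has_sum (\<Sum>n\<in>{k+1..0}. - of_int n)) UNIV"
      by (rule has_sum_finite_neutralI[where B = "{k+1..0}"]) (use False in \<open>auto simp: H_def\<close>)
    also have "(\<Sum>n\<in>{k+1..0}. - of_int n) = (\<Sum>n\<in>{0..-k-1}. of_int n :: complex)"
      by (rule sum.reindex_bij_witness[where i = uminus and j = uminus]) auto
    also have "\<dots> = (\<Sum>n\<in>{1..-k-1}. of_int n)"
      by (rule sum.mono_neutral_right) auto
    also have "\<dots> = of_int (-k-1) * (of_int (-k-1) + 1) / 2"
      by (rule gauss') (use False in simp)
    also have "\<dots> = of_int k * (of_int k + 1) / 2" by (simp add: ring_distribs)
    finally show ?thesis .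
  qed
  have 2: "((\<lambda>n. of_int n * \<psi> n - of_int (n - k) * \<psi> (n - k)) has_sum (d - d)) UNIV"
    using has_sum_diff[OF d, of "\<lambda>n. of_int (n - k) * \<psi> (n - k)" d]
      has_sum_int_shift[of "\<lambda>n. of_int n * \<psi> n" "-k" d] d by simp
  have 3: "((\<lambda>n. (- of_int k) * \<psi> (n - k)) has_sum (- of_int k) * c) UNIV"
    using has_sum_int_shift[of \<psi> "-k" c] c by (intro has_sum_cmult_right) simp
  have "((\<lambda>n. (of_int n * (H n - H (n - k))) +
      ((of_int n * \<psi> n - of_int (n - k) * \<psi> (n - k)) + (- of_int k) * \<psi> (n - k)))
      has_sum (of_int k * (of_int k + 1) / 2 + ((d - d) + (- of_int k) * c))) UNIV"
    using has_sum_add[OF 1 has_sum_add[OF 2 3]] .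
  also have "of_int k * (of_int k + 1) / 2 + ((d - d) + (- of_int k) * c) = (of_int k)\<^sup>2 / 2"
  proof -
    have "2 * c = 1" using c2 by simp
    then have "c = 1/2" by (simp add: nonzero_eq_divide_eq mult.commute)
    then show ?thesis by (simp add: power2_eq_square field_simps)
  qed
  finally have "((\<lambda>n. (of_int n * (H n - H (n - k))) +
      ((of_int n * \<psi> n - of_int (n - k) * \<psi> (n - k)) + (- of_int k) * \<psi> (n - k)))
      has_sum ((of_int k)\<^sup>2 / 2)) UNIV" .
  moreover have "(\<lambda>n. (of_int n * (H n - H (n - k))) +
      ((of_int n * \<psi> n - of_int (n - k) * \<psi> (n - k)) + (- of_int k) * \<psi> (n - k))) =
      (\<lambda>n. of_int n * (\<phi> n - \<phi> (n - k)))"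
    by (rule ext) (simp add: \<psi>_def ring_distribs)
  ultimately show ?thesis by simp
qed

section \<open>The fourfold sum\<close>

locale nome =
  fixes q :: complex
  assumes q_nonzero: "q \<noteq> 0" and norm_q_less_1: "norm q < 1"
begin

abbreviation r :: real where "r \<equiv> norm q"

text \<open>Used for \<open>\<epsilon> = \<plusminus>1\<close>. At the pole \<open>n = 0\<close>, \<open>\<epsilon> = 1\<close> the value is \<open>0\<close>.\<close>

definition kern :: "complex \<Rightarrow> int \<Rightarrow> complex" where
  "kern \<epsilon> n = 1 / (1 - \<epsilon> * q powi n)"

lemma r_pos: "0 < r" and r_less_1: "r < 1"
  using q_nonzero norm_q_less_1 by auto

lemma powi_ne_1: "n \<noteq> 0 \<Longrightarrow> norm \<epsilon> = 1 \<Longrightarrow> \<epsilon> * q powi n \<noteq> 1"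
proof
  assume "n \<noteq> 0" "norm \<epsilon> = 1" "\<epsilon> * q powi n = 1"
  then have "r powi n = 1" by (metis mult_1 norm_mult norm_one norm_power_int)
  moreover have "r powi n < 1 \<or> r powi n > 1"
  proof (cases "n > 0")
    case True then show ?thesis
      using r_pos r_less_1 by (simp add: power_int_def power_less_one_iff)
  next
    case False
    then have "r ^ nat (-n) < 1" using \<open>n \<noteq> 0\<close> r_pos r_less_1 by (simp add: power_less_one_iff)
    then have "1 < inverse (r ^ nat (-n))" using r_pos by (intro one_less_inverse) auto
    then show ?thesis using False \<open>n \<noteq> 0\<close> by (simp add: power_int_def power_inverse)
  qed
  ultimately show False by auto
qed

text \<open>The constant contains \<open>norm (kern \<epsilon> 0)\<close> for the sake of n = 0,
  where the two terms of the denominator have equal modulus and the triangle inequality gives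
  nothing.\<close>

lemma norm_kern_le:
  assumes "norm \<epsilon> = 1"
  shows "norm (kern \<epsilon> n) \<le> (1 + norm (kern \<epsilon> 0)) / (1 - r) * r powi (max 0 (- n))"
proof -
  define K where "K = (1 + norm (kern \<epsilon> 0))"
  have K: "K \<ge> 1" "K \<ge> norm (kern \<epsilon> 0)" by (auto simp: K_def)
  consider "n = 0" | "n > 0" | "n < 0" by linarith
  then show ?thesis
  proof cases
    case 1
    have "K \<le> K / (1 - r)" using K r_pos r_less_1 by (simp add: field_simps)
    then show ?thesis using 1 by (simp flip: K_def) (use K in linarith)
  next
    case 2
    have "r powi n \<le> r"
      using 2 r_pos r_less_1 power_decreasing[of 1 "nat n" r] by (simp add: power_int_def)
    then have "1 - r \<le> norm (1 - \<epsilon> * q powi n)"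
      using norm_triangle_ineq2[of 1 "\<epsilon> * q powi n"] assms by (simp add: norm_mult norm_power_int)
    then have "norm (kern \<epsilon> n) \<le> 1 / (1 - r)"
      using r_less_1 by (simp add: kern_def norm_divide frac_le)
    also have "\<dots> \<le> K / (1 - r)" using K r_less_1 by (simp add: divide_right_mono)
    finally show ?thesis using 2 by (simp flip: K_def)
  next
    case 3
    have "r powi (-n) \<le> r"
      using 3 r_pos r_less_1 power_decreasing[of 1 "nat (-n)" r] by (simp add: power_int_def)
    then have "1 - r \<le> 1 - r powi (-n)" by simp
    then have "(1 - r) * r powi n \<le> (1 - r powi (-n)) * r powi n"
      using r_pos by (intro mult_right_mono) auto
    also have "\<dots> = r powi n - 1" using r_pos by (simp add: algebra_simps power_int_minus)
    also have "\<dots> \<le> norm (1 - \<epsilon> * q powi n)"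
      using norm_triangle_ineq2[of "\<epsilon> * q powi n" 1] assms
      by (simp add: norm_mult norm_power_int norm_minus_commute)
    finally have "norm (kern \<epsilon> n) \<le> 1 / ((1 - r) * r powi n)"
      using r_less_1 r_pos powi_ne_1[of n \<epsilon>] 3 assms unfolding kern_def norm_divide norm_one
      by (intro divide_left_mono mult_pos_pos zero_less_power_int) auto
    also have "\<dots> = 1 / (1 - r) * r powi (-n)" by (simp add: power_int_minus field_simps)
    also have "\<dots> \<le> K / (1 - r) * r powi (-n)" using K r_less_1 r_pos
      by (intro mult_right_mono divide_right_mono) auto
    finally show ?thesis using 3 by (simp flip: K_def)
  qed
qed

lemma norm_kern_leE:
  assumes "norm \<epsilon> = 1"
  obtains K where "K > 0" "\<And>n. norm (kern \<epsilon> n) \<le> K * r powi (max 0 (- n))"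
proof
  show "(1 + norm (kern \<epsilon> 0)) / (1 - r) > 0" using r_less_1 by (auto intro!: divide_pos_pos add_pos_nonneg)
qed (use norm_kern_le[OF assms] in auto)

lemma kern_minus:
  assumes "\<epsilon> * \<epsilon> = 1" "\<epsilon> * q powi n \<noteq> 1"
  shows "kern \<epsilon> (- n) = 1 - kern \<epsilon> n"
proof -
  define X where "X = \<epsilon> * q powi n"
  have X: "X \<noteq> 0" "X \<noteq> 1" using assms q_nonzero by (auto simp: X_def)
  have "\<epsilon> * q powi (-n) = 1 / X"
  proof -
    have "\<epsilon> \<noteq> 0" using assms by auto
    have "\<epsilon> = 1 / \<epsilon>" using assms(1) \<open>\<epsilon> \<noteq> 0\<close> by (simp add: field_simps)
    then have "\<epsilon> * q powi (-n) = 1 / \<epsilon> * (1 / q powi n)" by (simp add: power_int_minus divide_inverse)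
    then show ?thesis by (simp add: X_def)
  qed
  then have "kern \<epsilon> (- n) = 1 / (1 - 1 / X)" by (simp add: kern_def)
  moreover have "kern \<epsilon> n = 1 / (1 - X)" by (simp add: kern_def X_def)
  moreover have "1 / (1 - 1 / X) = 1 - 1 / (1 - X)" using X by (simp add: field_simps)
  ultimately show ?thesis by simp
qed

end

lemma summable_on_product_nonneg:
  fixes u :: "'a \<Rightarrow> real" and v :: "'b \<Rightarrow> real"
  assumes "u summable_on UNIV" "v summable_on UNIV" "\<And>x. u x \<ge> 0" "\<And>y. v y \<ge> 0"
  shows "(\<lambda>(x, y). u x * v y) summable_on UNIV"
proof -
  have "(\<lambda>(x, y). u x * v y) summable_on (UNIV \<times> UNIV)"
  proof (rule summable_on_SigmaI)
    show "((\<lambda>y. case (x, y) of (x, y) \<Rightarrow> u x * v y) has_sum (u x * infsum v UNIV)) UNIV" for x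
      using assms(2) by (auto intro!: has_sum_cmult_right)
    show "(\<lambda>x. u x * infsum v UNIV) summable_on UNIV"
      using assms(1) by (rule summable_on_cmult_left)
  qed (use assms in auto)
  then show ?thesis by simp
qed

section \<open>Partial fractions and telescoping convolutions\<close>

context nome
begin

abbreviation f :: "int \<Rightarrow> complex" where "f \<equiv> kern (-1)"
abbreviation g :: "int \<Rightarrow> complex" where "g \<equiv> kern 1"

text \<open>Put A = \<epsilon> q^a and B = \<delta> q^(m-a). The product AB does not depend on a,
  and 1/(1-A) + 1/(1-B) - 1 = (1-AB)/((1-A)(1-B)). Reflecting the second kernel turns the sum into a
  difference, which telescopes in a when the signs agree. Two minus signs give \<open>g m\<close>,
  mixed signs give \<open>f m\<close>.\<close>

lemma kern_mult:
  assumes "\<epsilon> * \<epsilon> = 1" "\<delta> * \<delta> = 1"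
    and "\<epsilon> * q powi a \<noteq> 1" "\<delta> * q powi (m - a) \<noteq> 1" "\<epsilon> * \<delta> * q powi m \<noteq> 1"
  shows "kern \<epsilon> a * kern \<delta> (m - a) = kern (\<epsilon> * \<delta>) m * (kern \<epsilon> a - kern \<delta> (a - m))"
proof -
  define A B where "A = \<epsilon> * q powi a" and "B = \<delta> * q powi (m - a)"
  have AB: "A * B = \<epsilon> * \<delta> * q powi m"
    using q_nonzero by (simp add: A_def B_def power_int_diff)
  have "kern \<delta> (a - m) = 1 - kern \<delta> (m - a)"
    using kern_minus[of \<delta> "m - a"] assms by simp
  also have "kern \<delta> (m - a) = 1 / (1 - B)" by (simp add: kern_def B_def)
  finally have 1: "kern \<delta> (a - m) = 1 - 1 / (1 - B)" .
  have 2: "kern \<epsilon> a = 1 / (1 - A)" "kern \<delta> (m - a) = 1 / (1 - B)" "kern (\<epsilon> * \<delta>) m = 1 / (1 - A * B)"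
    by (simp_all add: kern_def A_def B_def AB[unfolded A_def B_def])
  have "A \<noteq> 1" "B \<noteq> 1" using assms by (auto simp: A_def B_def)
  moreover have "A * B \<noteq> 1" unfolding AB by (rule assms(5))
  ultimately show ?thesis unfolding 1 2 by (simp add: divide_simps) algebra
qed

lemma f_defined: "- 1 * q powi n \<noteq> 1"
proof (cases "n = 0")
  case False
  then show ?thesis using powi_ne_1[of n "-1"] by simp
qed simp

lemma g_defined: "n \<noteq> 0 \<Longrightarrow> 1 * q powi n \<noteq> 1"
  using powi_ne_1[of n "1"] by simp

lemma f_minus: "f (- n) = 1 - f n"
  using f_defined by (intro kern_minus) auto

lemma f_times: "(1 + q powi n) * f n = 1"
proof -
  have "1 + q powi n \<noteq> 0" using f_defined[of n] by (simp add: add_eq_0_iff minus_equation_iff)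
  then show ?thesis by (simp add: kern_def)
qed

text \<open>For positive n the reflection \<open>kern_minus\<close> turns the distance to 1 into a
  kernel value at -n, so the decay is two-sided once the step is removed.\<close>

lemma norm_kern_step_le:
  assumes "\<epsilon> * \<epsilon> = 1" "norm \<epsilon> = 1"
  obtains K where "\<And>n. norm (kern \<epsilon> n - (if n > 0 then 1 else 0)) \<le> K * r ^ nat \<bar>n\<bar>"
proof -
  obtain K where K: "K > 0" "\<And>n. norm (kern \<epsilon> n) \<le> K * r powi (max 0 (- n))"
    using norm_kern_leE[OF assms(2)] by metis
  have "norm (kern \<epsilon> n - (if n > 0 then 1 else 0)) \<le> K * r ^ nat \<bar>n\<bar>" for n
  proof (cases "n > 0")
    case True
    then have "norm (kern \<epsilon> n - (if n > 0 then 1 else 0)) = norm (kern \<epsilon> (- n))"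
      using kern_minus[of \<epsilon> n] powi_ne_1[of n \<epsilon>] assms by (simp add: norm_minus_commute)
    with K(2)[of "- n"] True show ?thesis by (simp add: power_int_def)
  next
    case False
    with K(2)[of n] show ?thesis by (simp add: power_int_def)
  qed
  then show thesis using that by blast
qed

lemma summable_kern_step:
  assumes "\<epsilon> * \<epsilon> = 1" "norm \<epsilon> = 1"
  shows "(\<lambda>n. of_int n ^ k * (kern \<epsilon> n - (if n > 0 then 1 else 0))) summable_on UNIV"
proof -
  obtain K where K: "\<And>n. norm (kern \<epsilon> n - (if n > 0 then 1 else 0)) \<le> K * r ^ nat \<bar>n\<bar>"
    using norm_kern_step_le[OF assms] by metis
  have "(\<lambda>n. norm (of_int n ^ k * (kern \<epsilon> n - (if n > 0 then 1 else 0)))) summable_on UNIV"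
  proof (rule summable_on_int_geometric_bound[where K = K and r = r and k = k])
    fix n :: int
    have "\<bar>real_of_int n\<bar> ^ k * norm (kern \<epsilon> n - (if n > 0 then 1 else 0)) \<le> \<bar>real_of_int n\<bar> ^ k * (K * r ^ nat \<bar>n\<bar>)"
      by (intro mult_left_mono K) auto
    then show "norm (of_int n ^ k * (kern \<epsilon> n - (if n > 0 then 1 else 0))) \<le> K * (\<bar>real_of_int n\<bar> ^ k * r ^ nat \<bar>n\<bar>)"
      by (simp add: norm_mult norm_power mult_ac)
  qed (use r_less_1 in auto)
  then show ?thesis by (rule abs_summable_summable)
qed

lemma f_telescope: "((\<lambda>n. f n - f (n - k)) has_sum of_int k) UNIV"
  using summable_kern_step[of "-1" 0] by (intro has_sum_int_telescope) simp

lemma f_telescope_moment: "((\<lambda>n. of_int n * (f n - f (n - k))) has_sum (of_int k)\<^sup>2 / 2) UNIV"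
  using summable_kern_step[of "-1" 0] summable_kern_step[of "-1" 1]
  by (intro has_sum_int_telescope_moment) (simp_all add: f_minus)

definition \<beta> :: complex where "\<beta> = (\<Sum>\<^sub>\<infinity>a. f a * f (- a))"
definition \<gamma> :: complex where "\<gamma> = (\<Sum>\<^sub>\<infinity>m. of_int m * (g m - f m))"
text \<open>The convolution of f with itself. At m = 0 the factor g has its pole and nothing
  telescopes, so the value there is a constant of its own.\<close>

definition conv2 :: "int \<Rightarrow> complex" where "conv2 m = (if m = 0 then \<beta> else of_int m * g m)"

lemma has_sum_\<gamma>: "((\<lambda>m. of_int m * (g m - f m)) has_sum \<gamma>) UNIV"
proof -
  have "(\<lambda>m. of_int m * (g m - f m)) summable_on UNIV"
    using summable_on_add[OF summable_kern_step[of 1 1] summable_on_uminus[THEN iffD2, OF summable_kern_step[of "-1" 1]]]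
    by (simp add: algebra_simps)
  then show ?thesis unfolding \<gamma>_def by (rule has_sum_infsum)
qed

lemma norm_summable_kern_self:
  assumes "norm \<epsilon> = 1"
  shows "(\<lambda>a. norm (kern \<epsilon> a * kern \<epsilon> (- a))) summable_on UNIV"
proof -
  obtain K where K: "K > 0" "\<And>n. norm (kern \<epsilon> n) \<le> K * r powi (max 0 (- n))"
    using norm_kern_leE[OF assms] by metis
  show "(\<lambda>a. norm (kern \<epsilon> a * kern \<epsilon> (- a))) summable_on UNIV"
  proof (rule summable_on_int_geometric_bound[where K = "K * K" and r = r and k = 0])
    fix n :: int
    have "norm (kern \<epsilon> n * kern \<epsilon> (- n)) \<le> (K * r powi (max 0 (- n))) * (K * r powi (max 0 n))"
      unfolding norm_mult using K(2)[of n] K(2)[of "-n"] K(1) by (intro mult_mono) auto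
    also have "\<dots> = K * K * (r powi (max 0 (- n)) * r powi (max 0 n))" by simp
    also have "r powi (max 0 (- n)) * r powi (max 0 n) = r ^ nat \<bar>n\<bar>"
      by (simp add: max_def power_int_def)
    finally show "norm (kern \<epsilon> n * kern \<epsilon> (- n)) \<le> K * K * (\<bar>real_of_int n\<bar> ^ 0 * r ^ nat \<bar>n\<bar>)" by simp
  qed (use r_less_1 in auto)
qed

lemma has_sum_conv2: "((\<lambda>a. f a * f (m - a)) has_sum conv2 m) UNIV"
proof (cases "m = 0")
  case True
  from norm_summable_kern_self[of "-1"]
  show ?thesis unfolding \<beta>_def conv2_def using True
    by (auto intro!: has_sum_infsum dest!: abs_summable_summable)
next
  case False
  have "f a * f (m - a) = g m * (f a - f (a - m))" for a
    using kern_mult[of "-1" "-1" a m] f_defined g_defined[OF False] by simp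
  moreover have "((\<lambda>a. g m * (f a - f (a - m))) has_sum (g m * of_int m)) UNIV"
    by (intro has_sum_cmult_right f_telescope)
  ultimately show ?thesis using False by (simp add: conv2_def mult.commute)
qed

text \<open>A second partial fraction turns g m f(n-m) into f n (g m - f(m-n)), and 1 + q^n cancels
  f n. Inserting f m between the two kernels separates \<gamma> from a telescoping first moment,
  which gives n^2/2; the term m = 0 gives \<beta>.\<close>

lemma has_sum_conv3:
  "((\<lambda>m. (1 + q powi n) * (conv2 m * f (n - m))) has_sum (\<beta> + \<gamma> + (of_int n)\<^sup>2 / 2)) UNIV"
proof -
  have "(1 + q powi n) * (conv2 m * f (n - m)) =
      (if m = 0 then \<beta> else 0) + (of_int m * (g m - f m) + of_int m * (f m - f (m - n)))" for m
  proof (cases "m = 0")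
    case True
    then show ?thesis using f_times[of n] by (simp add: conv2_def mult_ac)
  next
    case False
    have "g m * f (n - m) = f n * (g m - f (m - n))"
      using kern_mult[of "1" "-1" m n] f_defined g_defined[OF False] by simp
    then have "(1 + q powi n) * (conv2 m * f (n - m)) = of_int m * (((1 + q powi n) * f n) * (g m - f (m - n)))"
      using False by (simp add: conv2_def)
    then show ?thesis unfolding f_times using False by (simp add: algebra_simps)
  qed
  moreover have "((\<lambda>m::int. if m = 0 then \<beta> else 0) has_sum \<beta>) UNIV"
    by (rule has_sum_finite_neutralI[where B = "{0}"]) auto
  note has_sum_add[OF this has_sum_add[OF has_sum_\<gamma> f_telescope_moment[of n]]]
  ultimately show ?thesis by (simp add: add.assoc)
qed

lemma theta_summand_eq:
  "theta_summand j k q (a, b, c, d) =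
    2 * (1 + q powi (j * c + k * d)) * (f a * f b * f c * f d * f (j * c + k * d - a - b) * f (- c - d))"
  by (simp add: theta_summand_def kern_def)

text \<open>\<open>\<bar>f n\<bar>\<close> decays like \<open>r\<^bsup>max 0 (-n)\<^esup>\<close>, and \<open>\<bar>a\<bar> + \<bar>b\<bar> + \<bar>n - a - b\<bar> - \<bar>n\<bar>\<close> is twice the
  combined exponent of \<open>(1 + q\<^sup>n) f a f b f (n - a - b)\<close>. A root \<open>\<rho>\<close> of \<open>r\<close> absorbs the loss
  from \<open>n = j c + k d\<close>.\<close>

lemma norm_summable_theta_summand:
  "(\<lambda>x. norm (theta_summand j k q x)) summable_on UNIV"
proof -
  obtain K where K: "K > 0" "\<And>n. norm (f n) \<le> K * r powi (max 0 (- n))"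
    using norm_kern_leE[of "-1"] by (metis norm_minus_cancel norm_one)
  \<comment> \<open>Both |j| and |k| are at most N - 1. Scaling the exponents by 2N therefore pays
    for |n| <= (N - 1)(|c| + |d|) and still leaves |c| + |d|.\<close>
  define N where "N = 1 + \<bar>j\<bar> + \<bar>k\<bar>"
  have N: "N \<ge> 1" by (simp add: N_def)
  define \<rho> where "\<rho> = root (nat (2 * N)) r"
  have \<rho>: "0 < \<rho>" "\<rho> < 1" and \<rho>r: "\<rho> powi (2 * N) = r"
    using N r_pos r_less_1 by (auto simp: \<rho>_def power_int_def)
  define u where "u = (\<lambda>n::int. \<rho> ^ nat \<bar>n\<bar>)"
  have u: "u summable_on UNIV" "\<And>n. u n \<ge> 0"
    using summable_on_int_power_geometric[of \<rho> 0] \<rho> by (auto simp: u_def)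
  have u4: "(\<lambda>(a, b, c, d). u a * (u b * (u c * u d))) summable_on UNIV"
    using summable_on_product_nonneg[OF u(1) summable_on_product_nonneg[OF u(1) summable_on_product_nonneg[OF u(1) u(1)]]] u(2)
    by (simp add: case_prod_unfold)
  show ?thesis
  proof (rule Infinite_Sum.abs_summable_on_comparison_test')
    show "(\<lambda>x. 4 * K ^ 6 * (case x of (a, b, c, d) \<Rightarrow> u a * (u b * (u c * u d)))) summable_on UNIV"
      by (intro summable_on_cmult_right u4)
  next
    fix x :: "int \<times> int \<times> int \<times> int"
    obtain a b c d where x: "x = (a, b, c, d)" by (cases x) auto
    define n where "n = j * c + k * d"
    define p where "p = (\<lambda>n::int. max 0 (- n))"
    have r_add: "r powi (x + y) = r powi x * r powi y" for x y
      using r_pos by (simp add: power_int_add)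
    have Kp: "norm (f i) \<le> K * r powi p i" for i using K(2)[of i] by (simp only: p_def)
    have "norm (1 + q powi n) \<le> 1 + r powi n"
      using norm_triangle_ineq[of 1 "q powi n"] by (simp add: norm_power_int)
    also have "\<dots> \<le> 2 * r powi (- p n)"
      using r_pos r_less_1 by (auto simp: p_def max_def power_int_def power_le_one one_le_inverse)
    finally have n: "norm (1 + q powi n) \<le> 2 * r powi (- p n)" .
    have "norm (theta_summand j k q x) = 2 * norm (1 + q powi n) *
        (norm (f a) * norm (f b) * norm (f c) * norm (f d) * norm (f (n - a - b)) * norm (f (- c - d)))"
      unfolding x theta_summand_eq n_def by (simp add: norm_mult del: distrib_left_numeral)
    also have "\<dots> \<le> 2 * (2 * r powi (- p n)) * ((K * r powi p a) * (K * r powi p b) * (K * r powi p c) *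
        (K * r powi p d) * (K * r powi p (n - a - b)) * (K * r powi p (- c - d)))"
      by (intro mult_mono mult_nonneg_nonneg Kp n) (use K r_pos in auto)
    also have "\<dots> = 4 * K ^ 6 * (r powi (- p n) * r powi p a * r powi p b * r powi p c * r powi p d *
        r powi p (n - a - b) * r powi p (- c - d))"
      by (simp add: power_numeral_reduce mult_ac)
    also have "r powi (- p n) * r powi p a * r powi p b * r powi p c * r powi p d *
        r powi p (n - a - b) * r powi p (- c - d) =
        r powi (- p n + p a + p b + p c + p d + p (n - a - b) + p (- c - d))"
      by (simp only: r_add)
    also have "\<dots> = \<rho> powi (2 * N * (- p n + p a + p b + p c + p d + p (n - a - b) + p (- c - d)))"
      unfolding \<rho>r[symmetric] by (simp add: power_int_mult)
    also have "\<dots> \<le> \<rho> powi (\<bar>a\<bar> + \<bar>b\<bar> + \<bar>c\<bar> + \<bar>d\<bar>)"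
    proof (rule power_int_decreasing)
      let ?P = "- p n + p a + p b + p (n - a - b)" and ?R = "p c + p d + p (- c - d)"
      have p: "2 * p x = \<bar>x\<bar> - x" for x by (auto simp: p_def)
      have "2 * ?P = \<bar>a\<bar> + \<bar>b\<bar> + \<bar>n - a - b\<bar> - \<bar>n\<bar>"
        by (simp add: distrib_left p)
      moreover have "\<bar>n\<bar> \<le> \<bar>a\<bar> + \<bar>b\<bar> + \<bar>n - a - b\<bar>" by linarith
      moreover have "x \<ge> 0 \<and> 2 * x \<ge> y - z" if "2 * x = y + w - z" "z \<le> y + w" "w \<ge> 0" for w x y z :: int
        using that by simp
      ultimately have P: "?P \<ge> 0" "2 * ?P \<ge> \<bar>a\<bar> + \<bar>b\<bar> - \<bar>n\<bar>" by (meson abs_ge_zero)+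
      have "2 * ?R = \<bar>c\<bar> + \<bar>d\<bar> + \<bar>c + d\<bar>"
        by (simp add: distrib_left p)
      then have R: "2 * ?R \<ge> \<bar>c\<bar> + \<bar>d\<bar>" by simp
      have "\<bar>n\<bar> \<le> \<bar>j\<bar> * \<bar>c\<bar> + \<bar>k\<bar> * \<bar>d\<bar>"
        unfolding n_def by (metis abs_mult abs_triangle_ineq)
      also have "\<dots> \<le> (N - 1) * \<bar>c\<bar> + (N - 1) * \<bar>d\<bar>"
        by (intro add_mono mult_right_mono) (auto simp: N_def)
      finally have n: "\<bar>n\<bar> \<le> N * (\<bar>c\<bar> + \<bar>d\<bar>) - \<bar>c\<bar> - \<bar>d\<bar>" by (simp add: algebra_simps)
      have "1 * (2 * ?P) \<le> N * (2 * ?P)" using N P by (intro mult_right_mono) auto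
      moreover have "N * (2 * ?R) \<ge> N * (\<bar>c\<bar> + \<bar>d\<bar>)" using N R by (intro mult_left_mono) auto
      ultimately have "\<bar>a\<bar> + \<bar>b\<bar> + \<bar>c\<bar> + \<bar>d\<bar> \<le> N * (2 * ?P) + N * (2 * ?R)" using P n by linarith
      also have "\<dots> = 2 * N * (- p n + p a + p b + p c + p d + p (n - a - b) + p (- c - d))"
        by (simp add: algebra_simps)
      finally show "\<bar>a\<bar> + \<bar>b\<bar> + \<bar>c\<bar> + \<bar>d\<bar> \<le> \<dots>" .
    qed (use \<rho> in auto)
    also have "\<rho> powi (\<bar>a\<bar> + \<bar>b\<bar> + \<bar>c\<bar> + \<bar>d\<bar>) = u a * (u b * (u c * u d))"
    proof -
      have "u i = \<rho> powi \<bar>i\<bar>" for i by (simp add: u_def power_int_def)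
      then show ?thesis using \<rho> by (simp add: power_int_add)
    qed
    finally show "norm (theta_summand j k q x) \<le> 4 * K ^ 6 * (case x of (a, b, c, d) \<Rightarrow> u a * (u b * (u c * u d)))"
      using K by (simp add: x mult_left_mono)
  qed
qed

section \<open>Reduction of the fourfold sum to \<beta> + \<gamma> and E\<close>

abbreviation fff :: "int \<Rightarrow> int \<Rightarrow> complex" where "fff c d \<equiv> f c * f d * f (- c - d)"

text \<open>The substitution b = m - a makes the sum over a a value of \<open>conv2\<close> and the
  sum over m an instance of \<open>has_sum_conv3\<close>. Both iterated sums are justified by
  absolute convergence of the fourfold family.\<close>

lemma has_sum_theta_inner:
  shows "((\<lambda>(c, d). 2 * fff c d * (\<beta> + \<gamma> + (of_int (j * c + k * d))\<^sup>2 / 2)) has_sum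
      (\<Sum>\<^sub>\<infinity>x. theta_summand j k q x)) UNIV"
    and "((\<lambda>(m, a). f a * f (m - a) * f (n - m)) has_sum ((\<beta> + \<gamma> + (of_int n)\<^sup>2 / 2) * f n)) UNIV"
proof -
  have *: "((\<lambda>((c, d), (m, a)). theta_summand j k q (a, m - a, c, d)) has_sum (\<Sum>\<^sub>\<infinity>x. theta_summand j k q x)) (UNIV \<times> UNIV)" for j k
  proof -
    have "(theta_summand j k q has_sum (\<Sum>\<^sub>\<infinity>x. theta_summand j k q x)) UNIV"
      by (intro has_sum_infsum abs_summable_summable[OF norm_summable_theta_summand])
    then show ?thesis
      by (subst has_sum_reindex_bij_witness[where S = "UNIV \<times> UNIV" and T = UNIV and h = "theta_summand j k q"
           and j = "\<lambda>((c, d), (m, a)). (a, m - a, c, d)" and i = "\<lambda>(a, b, c, d). ((c, d), (a + b, a))"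
           and s' = "(\<Sum>\<^sub>\<infinity>x. theta_summand j k q x)"]) auto
  qed
  have row: "((\<lambda>(m, a). theta_summand j k q (a, m - a, c, d)) has_sum
      2 * fff c d * (\<beta> + \<gamma> + (of_int (j * c + k * d))\<^sup>2 / 2)) (UNIV \<times> UNIV)" for j k c d
  proof (rule has_sum_SigmaI)
    let ?n = "j * c + k * d"
    show "(\<lambda>(m, a). theta_summand j k q (a, m - a, c, d)) summable_on UNIV \<times> UNIV"
      using summable_on_SigmaD1[where f = "\<lambda>(c, d) (m, a). theta_summand j k q (a, m - a, c, d)" and A = UNIV
          and B = "\<lambda>_. UNIV \<times> UNIV" and x = "(c, d)"] has_sum_imp_summable[OF *[of j k]]
      by (simp add: case_prod_unfold)
    show "((\<lambda>a. case (m, a) of (m, a) \<Rightarrow> theta_summand j k q (a, m - a, c, d)) has_sum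
        2 * fff c d * ((1 + q powi ?n) * (conv2 m * f (?n - m)))) UNIV" for m
    proof -
      have "theta_summand j k q (a, m - a, c, d) = 2 * fff c d * ((1 + q powi ?n) * f (?n - m)) * (f a * f (m - a))" for a
      proof -
        have "?n - a - (m - a) = ?n - m" by simp
        then show ?thesis unfolding theta_summand_eq by (simp only: mult_ac)
      qed
      moreover have "2 * fff c d * ((1 + q powi ?n) * f (?n - m)) * conv2 m = 2 * fff c d * ((1 + q powi ?n) * (conv2 m * f (?n - m)))"
        by (simp only: mult_ac)
      ultimately show ?thesis
        using has_sum_cmult_right[OF has_sum_conv2[of m], of "2 * fff c d * ((1 + q powi ?n) * f (?n - m))"]
        by (simp only: prod.case)
    qed
    show "((\<lambda>m. 2 * fff c d * ((1 + q powi ?n) * (conv2 m * f (?n - m)))) has_sum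
        2 * fff c d * (\<beta> + \<gamma> + (of_int ?n)\<^sup>2 / 2)) UNIV"
      by (intro has_sum_cmult_right has_sum_conv3)
  qed
  have "((\<lambda>x. case x of (c, d) \<Rightarrow> 2 * fff c d * (\<beta> + \<gamma> + (of_int (j * c + k * d))\<^sup>2 / 2)) has_sum
      (\<Sum>\<^sub>\<infinity>x. theta_summand j k q x)) UNIV"
    by (rule has_sum_SigmaD[OF *[of j k]]) (use row in \<open>auto simp: case_prod_unfold\<close>)
  then show "((\<lambda>(c, d). 2 * fff c d * (\<beta> + \<gamma> + (of_int (j * c + k * d))\<^sup>2 / 2)) has_sum
      (\<Sum>\<^sub>\<infinity>x. theta_summand j k q x)) UNIV" .
  have nz: "f i \<noteq> 0" for i using f_times[of i] by auto
  \<comment> \<open>For j = 1, k = 0, c = n, d = 0 the theta summand is the wanted term times the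
    constant 2 (1 + q^n) \<open>fff n 0\<close>. As (1 + q^n) f n = 1, the number \<kappa> is the
    inverse of that constant, so the second claim follows from a single row of the fourfold
    sum.\<close>
  define \<kappa> where "\<kappa> = f n / (2 * fff n 0)"
  have "\<kappa> * (2 * (1 + q powi n) * fff n 0) = (1 + q powi n) * (\<kappa> * (2 * fff n 0))"
    by (simp only: mult_ac)
  also have "\<kappa> * (2 * fff n 0) = f n" using nz by (simp add: \<kappa>_def)
  finally have "\<kappa> * (2 * (1 + q powi n) * fff n 0) = 1" unfolding f_times .
  then have "\<kappa> * theta_summand 1 0 q (a, m - a, n, 0) = f a * f (m - a) * f (n - m)" for m a
  proof -
    assume *: "\<kappa> * (2 * (1 + q powi n) * fff n 0) = 1"
    have "\<kappa> * theta_summand 1 0 q (a, m - a, n, 0) = (\<kappa> * (2 * (1 + q powi n) * fff n 0)) * (f a * f (m - a) * f (n - m))"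
      by (simp only: theta_summand_eq mult_ac mult_1 mult_zero_left add_0_right) simp
    then show ?thesis unfolding * by simp
  qed
  then have F: "(\<lambda>x. \<kappa> * (case x of (m, a) \<Rightarrow> theta_summand 1 0 q (a, m - a, n, 0))) = (\<lambda>(m, a). f a * f (m - a) * f (n - m))"
    by (simp add: fun_eq_iff)
  have V: "\<kappa> * (2 * fff n 0 * X) = X * f n" for X
    using nz by (simp add: \<kappa>_def)
  have "((\<lambda>(m, a). theta_summand 1 0 q (a, m - a, n, 0)) has_sum
      2 * fff n 0 * (\<beta> + \<gamma> + (of_int n)\<^sup>2 / 2)) UNIV"
    using row[of 1 0 n 0] by simp
  from has_sum_cmult_right[OF this, of \<kappa>]
  show "((\<lambda>(m, a). f a * f (m - a) * f (n - m)) has_sum ((\<beta> + \<gamma> + (of_int n)\<^sup>2 / 2) * f n)) UNIV"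
    unfolding F V .
qed

text \<open>This is n = 0 of the preceding double sum, with m = c + d; the factor 1/2 is
  \<open>f 0\<close>.\<close>

lemma has_sum_fff: "((\<lambda>(c, d). fff c d) has_sum (\<beta> + \<gamma>) / 2) UNIV"
proof -
  have "((\<lambda>(m, a). f a * f (m - a) * f (- m)) has_sum (\<beta> + \<gamma>) / 2) UNIV"
    using has_sum_theta_inner(2)[of 0] by (simp add: kern_def[of _ 0])
  then show ?thesis
    by (subst has_sum_reindex_bij_witness[where S = UNIV and T = UNIV and h = "\<lambda>(m, a). f a * f (m - a) * f (- m)"
       and j = "\<lambda>(c, d). (c + d, c)" and i = "\<lambda>(m, a). (a, m - a)" and s' = "(\<beta> + \<gamma>) / 2"]) auto
qed

definition E :: complex where "E = (\<Sum>\<^sub>\<infinity>(c, d). fff c d * (of_int c)\<^sup>2)"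

text \<open>Summability with the weight c^2 costs no new estimate: subtracting a multiple of
  \<open>has_sum_fff\<close> from the case j = 1, k = 0 of \<open>has_sum_theta_inner\<close> leaves
  exactly this family.\<close>

lemma has_sum_E: "((\<lambda>(c, d). fff c d * (of_int c)\<^sup>2) has_sum E) UNIV"
proof -
  have "((\<lambda>(c, d). 2 * fff c d * (\<beta> + \<gamma> + (of_int (1 * c + 0 * d))\<^sup>2 / 2) - 2 * (\<beta> + \<gamma>) * fff c d)
    has_sum ((\<Sum>\<^sub>\<infinity>x. theta_summand 1 0 q x) - 2 * (\<beta> + \<gamma>) * ((\<beta> + \<gamma>) / 2))) UNIV"
    using has_sum_diff[OF has_sum_theta_inner(1)[of 1 0] has_sum_cmult_right[OF has_sum_fff, of "2 * (\<beta> + \<gamma>)"]]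
    by (simp add: case_prod_unfold)
  then have "(\<lambda>(c, d). fff c d * (of_int c)\<^sup>2) summable_on UNIV"
    by (intro has_sum_imp_summable) (simp add: algebra_simps)
  then show ?thesis unfolding E_def by (rule has_sum_infsum)
qed

text \<open>Summing over d gives c^2 f c \<open>conv2 (- c)\<close>, and with X = q^c one has -g(-c)
  = X/(1-X) and f c = 1/(1+X). The exceptional value \<beta> of \<open>conv2\<close> at 0 is killed
  by c^2.\<close>

lemma has_sum_E_single: "((\<lambda>c. of_int c ^ 3 * (q powi c / (1 - q powi (2 * c)))) has_sum E) UNIV"
proof -
  have E: "((\<lambda>(c, d). fff c d * (of_int c)\<^sup>2) has_sum E) (UNIV \<times> UNIV)"
    unfolding UNIV_Times_UNIV by (rule has_sum_E)
  have row: "((\<lambda>d. fff c d * (of_int c)\<^sup>2) has_sum (of_int c)\<^sup>2 * f c * conv2 (- c)) UNIV" for c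
  proof -
    have "(\<lambda>d. fff c d * (of_int c)\<^sup>2) = (\<lambda>d. (of_int c)\<^sup>2 * f c * (f d * f (- c - d)))"
      by (simp only: mult_ac)
    then show ?thesis
      using has_sum_cmult_right[OF has_sum_conv2[of "-c"], of "(of_int c)\<^sup>2 * f c"] by (simp only:)
  qed
  have 1: "((\<lambda>c. (of_int c)\<^sup>2 * f c * conv2 (- c)) has_sum E) UNIV"
    by (rule has_sum_SigmaD[OF E]) (simp only: prod.case row)
  have 2: "(of_int c)\<^sup>2 * f c * conv2 (- c) = of_int c ^ 3 * (q powi c / (1 - q powi (2 * c)))" for c
  proof (cases "c = 0")
    case False
    define X where "X = q powi c"
    have X: "X \<noteq> 0" using q_nonzero by (simp add: X_def)
    have 1: "1 - 1 / X = - ((1 - X) / X)" using X by (simp add: diff_divide_distrib)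
    have "g (- c) = 1 / (1 - 1 / X)" by (simp add: kern_def X_def power_int_minus divide_inverse)
    also have "\<dots> = - (X / (1 - X))" unfolding 1 by simp
    finally have gX: "g (- c) = - (X / (1 - X))" .
    have fX: "f c = 1 / (1 + X)" by (simp add: kern_def X_def)
    have qX: "q powi (2 * c) = X * X" unfolding X_def mult_2 using q_nonzero by (intro power_int_add) simp
    have X2: "1 - X * X = (1 + X) * (1 - X)" by (simp add: algebra_simps)
    have "(of_int c)\<^sup>2 * f c * conv2 (- c) = (of_int c)\<^sup>2 * (1 / (1 + X)) * (of_int (- c) * - (X / (1 - X)))"
      using False by (simp only: conv2_def gX fX neg_equal_0_iff_equal if_False)
    also have "\<dots> = of_int c ^ 3 * (X / ((1 + X) * (1 - X)))"
      by (simp add: power2_eq_square power3_eq_cube)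
    also have "\<dots> = of_int c ^ 3 * (q powi c / (1 - q powi (2 * c)))"
      unfolding qX X2 by (simp only: X_def)
    finally show ?thesis .
  qed simp
  show ?thesis using 1 unfolding 2 .
qed

theorem has_sum_theta_summand:
  "(theta_summand j k q has_sum ((\<beta> + \<gamma>)\<^sup>2 + of_int (j\<^sup>2 + k\<^sup>2 - j * k) * E)) UNIV"
proof -
  note c2 = has_sum_E
  have d2: "((\<lambda>(c, d). fff c d * (of_int d)\<^sup>2) has_sum E) UNIV"
    by (subst has_sum_reindex_bij_witness[where S = UNIV and T = UNIV and h = "\<lambda>(c, d). fff c d * (of_int c)\<^sup>2"
       and j = "\<lambda>(c, d). (d, c)" and i = "\<lambda>(c, d). (d, c)" and s' = E])
      (use c2 in \<open>auto simp: mult_ac minus_diff_commute\<close>)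
  have e2: "((\<lambda>(c, d). fff c d * (of_int (c + d))\<^sup>2) has_sum E) UNIV"
    by (subst has_sum_reindex_bij_witness[where S = UNIV and T = UNIV and h = "\<lambda>(c, d). fff c d * (of_int c)\<^sup>2"
       and j = "\<lambda>(c, d). (- c - d, d)" and i = "\<lambda>(c, d). (- c - d, d)" and s' = E])
      (use c2 in \<open>auto simp: mult_ac power2_eq_square algebra_simps\<close>)
  \<comment> \<open>Since c^2, d^2 and (c+d)^2 all have the weighted sum E, the square (jc+kd)^2 is
    written as (j^2-jk) c^2 + (k^2-jk) d^2 + jk (c+d)^2.\<close>
  have jk: "((\<lambda>(c, d). of_int (j * j - j * k) * (fff c d * (of_int c)\<^sup>2)
         + (of_int (k * k - j * k) * (fff c d * (of_int d)\<^sup>2)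
         + of_int (j * k) * (fff c d * (of_int (c + d))\<^sup>2))) has_sum
       (of_int (j * j - j * k) * E + (of_int (k * k - j * k) * E + of_int (j * k) * E))) UNIV"
    using has_sum_add[OF has_sum_cmult_right[OF c2] has_sum_add[OF has_sum_cmult_right[OF d2] has_sum_cmult_right[OF e2]]]
    by (simp add: case_prod_unfold)
  note s = has_sum_add[OF has_sum_cmult_right[OF has_sum_fff, of "2 * (\<beta> + \<gamma>)"] jk]
  have "2 * (\<beta> + \<gamma>) * (case x of (c, d) \<Rightarrow> fff c d) + (case x of (c, d) \<Rightarrow> of_int (j * j - j * k) * (fff c d * (of_int c)\<^sup>2)
         + (of_int (k * k - j * k) * (fff c d * (of_int d)\<^sup>2)
         + of_int (j * k) * (fff c d * (of_int (c + d))\<^sup>2))) =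
      (case x of (c, d) \<Rightarrow> 2 * fff c d * (\<beta> + \<gamma> + (of_int (j * c + k * d))\<^sup>2 / 2))" for x
    by (simp add: case_prod_unfold power2_eq_square) (simp add: algebra_simps)
  then have "((\<lambda>(c, d). 2 * fff c d * (\<beta> + \<gamma> + (of_int (j * c + k * d))\<^sup>2 / 2)) has_sum
       2 * (\<beta> + \<gamma>) * ((\<beta> + \<gamma>) / 2) + (of_int (j * j - j * k) * E + (of_int (k * k - j * k) * E + of_int (j * k) * E))) UNIV"
    using s by simp
  moreover have "2 * (\<beta> + \<gamma>) * ((\<beta> + \<gamma>) / 2) + (of_int (j * j - j * k) * E + (of_int (k * k - j * k) * E + of_int (j * k) * E))
      = (\<beta> + \<gamma>)\<^sup>2 + of_int (j\<^sup>2 + k\<^sup>2 - j * k) * E"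
    by (simp add: power2_eq_square field_simps)
  ultimately have "infsum (theta_summand j k q) UNIV = (\<beta> + \<gamma>)\<^sup>2 + of_int (j\<^sup>2 + k\<^sup>2 - j * k) * E"
    using has_sum_unique[OF has_sum_theta_inner(1)[of j k]] by simp
  moreover have "(theta_summand j k q has_sum infsum (theta_summand j k q) UNIV) UNIV"
    by (intro has_sum_infsum abs_summable_summable[OF norm_summable_theta_summand])
  ultimately show ?thesis by simp
qed

end

section \<open>Squares of Lambert series\<close>

text \<open>The polylogarithms of order \<open>-1\<close>, \<open>-2\<close> and \<open>-3\<close>, as rational functions (\<open>0\<close> at the pole \<open>1\<close>).\<close>

definition li1 :: "complex \<Rightarrow> complex" where "li1 x = x / (1 - x)\<^sup>2"
definition li2 :: "complex \<Rightarrow> complex" where "li2 x = x * (1 + x) / (1 - x) ^ 3"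
definition li3 :: "complex \<Rightarrow> complex" where "li3 x = x * (1 + 4 * x + x\<^sup>2) / (1 - x) ^ 4"

text \<open>As li3 arises from li1 by applying x d/dx twice, this is the degenerate form of the
  differential equation expressing the second derivative of the Weierstrass function by its square.
  It converts sums of squares of li1 into linear sums.\<close>

lemma li3_eq: "li3 x = li1 x + 6 * (li1 x)\<^sup>2"
proof (cases "x = 1")
  case False
  then have "1 - x \<noteq> 0" by simp
  then show ?thesis
    unfolding li1_def li3_def
    by (simp add: divide_simps power2_eq_square power4_eq_xxxx) algebra
qed (simp add: li1_def li3_def)

text \<open>In the sum of n x^n, adding the value at -x keeps the even n, twice: 2 * 2 = 4. For li3
  the same count gives 2 * 8 = 16.\<close>

lemma li1_duplicate:
  assumes "x\<^sup>2 \<noteq> 1"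
  shows "li1 x + li1 (- x) = 4 * li1 (x\<^sup>2)"
proof -
  have eq: "1 - x\<^sup>2 = (1 - x) * (1 + x)" by (simp add: power2_eq_square algebra_simps)
  have "1 - x \<noteq> 0" "1 + x \<noteq> 0" using assms eq by auto
  then show ?thesis unfolding li1_def eq
    by (simp add: divide_simps) (simp add: power2_eq_square algebra_simps)
qed

lemma li3_duplicate:
  assumes "x\<^sup>2 \<noteq> 1"
  shows "li3 x + li3 (- x) = 16 * li3 (x\<^sup>2)"
proof -
  have eq: "1 - x\<^sup>2 = (1 - x) * (1 + x)" by (simp add: power2_eq_square algebra_simps)
  have "1 - x \<noteq> 0" "1 + x \<noteq> 0" using assms eq by auto
  then show ?thesis unfolding li3_def eq
    by (simp add: divide_simps) (simp add: power2_eq_square power4_eq_xxxx algebra_simps)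
qed

lemma sums_li:
  fixes y :: complex
  assumes "norm y < 1"
  shows "(\<lambda>n. of_nat (Suc n) * y ^ Suc n) sums li1 y"
    and "(\<lambda>n. of_nat (Suc n) ^ 3 * y ^ Suc n) sums li3 y"
proof -
  define u where "u = (\<lambda>k n. of_nat n ^ k * y ^ n)"
  have "summable (\<lambda>n. norm (u k n))" for k
    using summable_power_geometric[of "norm y" k] assms by (simp add: u_def norm_mult norm_power)
  then have sm: "summable (u k)" for k by (rule summable_norm_cancel)
  define U where "U = (\<lambda>k. suminf (u k))"
  have U: "u k sums U k" for k unfolding U_def by (rule summable_sums[OF sm])
  have shift: "(\<lambda>n. u k (Suc n)) sums U k" if "k > 0" for k
  proof -
    have "u k 0 = 0" using that by (simp add: u_def)
    then show ?thesis using U[of k] sums_Suc_iff[of "u k" "U k"] by simp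
  qed
  have y: "1 - y \<noteq> 0" using assms by auto
  have "u 0 = (\<lambda>n. y ^ n)" by (simp add: u_def)
  then have U0: "U 0 = 1 / (1 - y)"
    using geometric_sums[OF assms] U[of 0] sums_unique2 by metis
  \<comment> \<open>Expanding (n+1)^k under an index shift gives a linear equation for
    \<open>U k\<close> in terms of the lower ones; the same is done for exponents 2 and 3.\<close>
  have "(\<lambda>n. y * (u 1 n + u 0 n)) sums (y * (U 1 + U 0))"
    by (intro sums_mult sums_add U)
  also have "(\<lambda>n. y * (u 1 n + u 0 n)) = (\<lambda>n. u 1 (Suc n))"
    by (simp add: u_def fun_eq_iff algebra_simps)
  finally have 1: "U 1 = y * (U 1 + U 0)" using shift[of 1] sums_unique2 by (metis zero_less_one)
  have "(\<lambda>n. y * (u 2 n + 2 * u 1 n + u 0 n)) sums (y * (U 2 + 2 * U 1 + U 0))"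
    by (intro sums_mult sums_add U)
  also have "(\<lambda>n. y * (u 2 n + 2 * u 1 n + u 0 n)) = (\<lambda>n. u 2 (Suc n))"
    by (simp add: u_def fun_eq_iff power2_eq_square algebra_simps)
  finally have 2: "U 2 = y * (U 2 + 2 * U 1 + U 0)" using shift[of 2] sums_unique2 by (metis zero_less_numeral)
  have "(\<lambda>n. y * (u 3 n + 3 * u 2 n + 3 * u 1 n + u 0 n)) sums (y * (U 3 + 3 * U 2 + 3 * U 1 + U 0))"
    by (intro sums_mult sums_add U)
  also have "(\<lambda>n. y * (u 3 n + 3 * u 2 n + 3 * u 1 n + u 0 n)) = (\<lambda>n. u 3 (Suc n))"
    by (simp add: u_def fun_eq_iff power2_eq_square power3_eq_cube algebra_simps)
  finally have 3: "U 3 = y * (U 3 + 3 * U 2 + 3 * U 1 + U 0)" using shift[of 3] sums_unique2 by (metis zero_less_numeral)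
  have "(1 - y) * U 1 = y * U 0" using 1 by (simp add: algebra_simps)
  then have "U 1 = y * U 0 / (1 - y)" using y by (simp add: nonzero_eq_divide_eq mult.commute)
  then have U1: "U 1 = y / (1 - y)\<^sup>2" unfolding U0 by (simp add: power2_eq_square)
  have "(1 - y) * U 2 = y * (2 * U 1 + U 0)" using 2 by (simp add: algebra_simps)
  then have U2: "U 2 = y * (2 * U 1 + U 0) / (1 - y)" using y by (simp add: nonzero_eq_divide_eq mult.commute)
  have "(1 - y) * U 3 = y * (3 * U 2 + 3 * U 1 + U 0)" using 3 by (simp add: algebra_simps)
  then have U3: "U 3 = y * (3 * U 2 + 3 * U 1 + U 0) / (1 - y)" using y by (simp add: nonzero_eq_divide_eq mult.commute)
  show "(\<lambda>n. of_nat (Suc n) * y ^ Suc n) sums li1 y"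
    using shift[of 1] unfolding U1 u_def li1_def by simp
  have "U 3 = li3 y"
    unfolding U3 U2 U1 U0 li3_def using y
    by (simp add: divide_simps power2_eq_square power4_eq_xxxx) algebra
  then show "(\<lambda>n. of_nat (Suc n) ^ 3 * y ^ Suc n) sums li3 y"
    using shift[of 3] unfolding u_def by simp
qed

lemma has_sum_int_square:
  fixes u :: "int \<Rightarrow> complex"
  assumes "(\<lambda>n. norm (u n)) summable_on UNIV" "(u has_sum p) UNIV"
  shows "((\<lambda>k. \<Sum>\<^sub>\<infinity>n. u n * u (n + k)) has_sum p\<^sup>2) UNIV"
    and "(\<lambda>n. u n * u (n + k)) summable_on UNIV"
proof -
  have "(\<lambda>x. norm (case x of (n, l) \<Rightarrow> u n * u l)) summable_on UNIV"
    using summable_on_product_nonneg[OF assms(1) assms(1)]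
    by (simp add: norm_mult case_prod_unfold)
  then have "(\<lambda>(n, l). u n * u l) summable_on UNIV \<times> UNIV"
    using abs_summable_summable by fastforce
  then have "((\<lambda>(n, l). u n * u l) has_sum p\<^sup>2) (UNIV \<times> UNIV)"
  proof (rule has_sum_SigmaI[rotated 2])
    show "((\<lambda>l. case (n, l) of (n, l) \<Rightarrow> u n * u l) has_sum u n * p) UNIV" for n
      using has_sum_cmult_right[OF assms(2), of "u n"] by simp
    show "((\<lambda>n. u n * p) has_sum p\<^sup>2) UNIV"
      using has_sum_cmult_left[OF assms(2), of p] by (simp add: power2_eq_square)
  qed
  then have *: "((\<lambda>(k, n). u n * u (n + k)) has_sum p\<^sup>2) (UNIV \<times> UNIV)"
    by (subst has_sum_reindex_bij_witness[where S = "UNIV \<times> UNIV" and T = "UNIV \<times> UNIV" and h = "\<lambda>(n, l). u n * u l"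
        and j = "\<lambda>(k, n). (n, n + k)" and i = "\<lambda>(n, l). (l - n, n)" and s' = "p\<^sup>2"]) auto
  show row: "(\<lambda>n. u n * u (n + k)) summable_on UNIV" for k
    using summable_on_SigmaD1[where f = "\<lambda>k n. u n * u (n + k)" and A = UNIV
        and B = "\<lambda>_. UNIV" and x = k] has_sum_imp_summable[OF *] by simp
  show "((\<lambda>k. \<Sum>\<^sub>\<infinity>n. u n * u (n + k)) has_sum p\<^sup>2) UNIV"
    by (rule has_sum_SigmaD[OF *]) (use row in auto)
qed

text \<open>Partial fractions in x: the product has double poles at x = 1 and x = 1/y. The double
  poles reproduce li1 with coefficient li1 y, and the simple poles come with opposite coefficients
  li2 y, so they telescope when x runs through the powers of q up to a sign.\<close>

lemma li1_mult:
  assumes "x \<noteq> 1" "y \<noteq> 1" "x * y \<noteq> 1"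
  shows "li1 x * li1 (x * y) = li1 y * (li1 x + li1 (x * y)) -
    y * (1 + y) / (1 - y) ^ 3 * (1 / (1 - x) - 1 / (1 - x * y))"
proof -
  have "1 - x \<noteq> 0" "1 - y \<noteq> 0" "1 - x * y \<noteq> 0" using assms by auto
  then show ?thesis unfolding li1_def
    by (simp add: divide_simps power2_eq_square power3_eq_cube) algebra
qed

section \<open>Squared sums and their diagonals\<close>

context nome
begin

text \<open>This is li2 at q^k, the coefficient of the telescoping part of \<open>li1_mult\<close>;
  its value at the pole k = 0 is 0.\<close>

definition s1 :: "int \<Rightarrow> complex" where
  "s1 k = q powi k * (1 + q powi k) / (1 - q powi k) ^ 3"

text \<open>Connects \<beta>, a convolution of kernels, with the li1 series of the theta side, and
  provides both the summability and the evenness of li1 along the powers of q.\<close>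

lemma kern_self:
  assumes "\<epsilon> * \<epsilon> = 1"
  shows "- (kern \<epsilon> n * kern \<epsilon> (- n)) = li1 (\<epsilon> * q powi n)"
proof (cases "\<epsilon> * q powi n = 1")
  case True
  then show ?thesis by (simp add: kern_def li1_def)
next
  case False
  define x where "x = \<epsilon> * q powi n"
  have "kern \<epsilon> n = 1 / (1 - x)" by (simp add: kern_def x_def)
  moreover have "1 - x \<noteq> 0" using False x_def by auto
  ultimately show ?thesis unfolding kern_minus[OF assms False] x_def[symmetric] li1_def
    by (simp add: divide_simps power2_eq_square) algebra
qed

lemma norm_summable_li1:
  assumes "\<epsilon> * \<epsilon> = 1" "norm \<epsilon> = 1"
  shows "(\<lambda>n. norm (li1 (\<epsilon> * q powi n))) summable_on UNIV"
  using norm_summable_kern_self[OF assms(2)] unfolding kern_self[OF assms(1), symmetric] by simp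

lemma li1_even: "\<epsilon> * \<epsilon> = 1 \<Longrightarrow> li1 (\<epsilon> * q powi (- n)) = li1 (\<epsilon> * q powi n)"
  by (metis kern_self minus_minus mult.commute)

definition \<alpha> :: complex where "\<alpha> = (\<Sum>\<^sub>\<infinity>n. li1 (q powi n))"

lemma has_sum_\<alpha>: "((\<lambda>n. li1 (q powi n)) has_sum \<alpha>) UNIV"
  unfolding \<alpha>_def using abs_summable_summable[OF norm_summable_li1[of 1]] by (intro has_sum_infsum) simp

lemma has_sum_minus_\<beta>: "((\<lambda>n. li1 (- 1 * q powi n)) has_sum (- \<beta>)) UNIV"
  using has_sum_uminusI[OF has_sum_conv2[of 0]] kern_self[of "-1"] by (simp add: conv2_def)

text \<open>Sums the right-hand side of \<open>li1_mult\<close> along a diagonal. The shift is by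
  -k, so the telescoping part enters with a plus sign.\<close>

lemma has_sum_cross:
  fixes u \<phi> :: "int \<Rightarrow> complex"
  assumes u: "(u has_sum p) UNIV" and \<phi>: "(\<lambda>n. \<phi> n - (if n > 0 then 1 else 0)) summable_on UNIV"
  shows "((\<lambda>n. a * (u n + u (n + k)) - b * (\<phi> n - \<phi> (n + k))) has_sum (2 * p * a + of_int k * b)) UNIV"
proof -
  have "((\<lambda>n. u (n + k)) has_sum p) UNIV" using u has_sum_int_shift[of u k p] by simp
  then have 1: "((\<lambda>n. a * (u n + u (n + k))) has_sum (a * (p + p))) UNIV"
    by (rule has_sum_cmult_right[OF has_sum_add[OF u]])
  have 2: "((\<lambda>n. b * (\<phi> n - \<phi> (n + k))) has_sum (b * of_int (- k))) UNIV"
    using has_sum_int_telescope[OF \<phi>, of "- k"] by (intro has_sum_cmult_right) simp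
  have 3: "a * (p + p) - b * of_int (- k) = 2 * p * a + of_int k * b" by (simp add: algebra_simps)
  show ?thesis using has_sum_diff[OF 1 2] unfolding 3 .
qed

text \<open>Square the sum of li1(-q^n), which is -\<beta> and has no poles. The diagonal k /= 0
  equals -2 \<beta> li1(q^k) + k \<open>s1 k\<close>, so the square can be solved for the sum of k
  \<open>s1 k\<close>, to be eliminated later.\<close>

lemma has_sum_s1:
  "((\<lambda>k. of_int k * s1 k) has_sum (\<beta>\<^sup>2 - (\<Sum>\<^sub>\<infinity>n. (li1 (- 1 * q powi n))\<^sup>2) + 2 * \<beta> * \<alpha>)) UNIV"
proof -
  define u where "u = (\<lambda>n. li1 (- 1 * q powi n))"
  have u: "(u has_sum (- \<beta>)) UNIV" unfolding u_def by (rule has_sum_minus_\<beta>)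
  have nu: "(\<lambda>n. norm (u n)) summable_on UNIV" unfolding u_def by (rule norm_summable_li1) auto
  have row: "((\<lambda>n. u n * u (n + k)) has_sum (2 * - \<beta> * li1 (q powi k) + of_int k * s1 k)) UNIV" if "k \<noteq> 0" for k
  proof -
    have "u n * u (n + k) = li1 (q powi k) * (u n + u (n + k)) - s1 k * (f n - f (n + k))" for n
    proof -
      have "(- 1 * q powi n) * q powi k = - 1 * q powi (n + k)"
        using q_nonzero by (simp add: power_int_add)
      then show ?thesis
        using li1_mult[of "- 1 * q powi n" "q powi k"] f_defined g_defined[OF that]
        by (simp only: u_def s1_def kern_def) simp
    qed
    then show ?thesis
      using has_sum_cross[OF u, of f "li1 (q powi k)" k "s1 k"] summable_kern_step[of "-1" 0] by simp
  qed
  define T where "T = (\<lambda>k. \<Sum>\<^sub>\<infinity>n. u n * u (n + k))"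
  \<comment> \<open>At k = 0 the second summand vanishes because li1 takes the value 0 at its pole;
    the main diagonal \<open>T 0\<close> is therefore carried separately.\<close>
  have T: "T k = (if k = 0 then T 0 else 0) + (2 * - \<beta> * li1 (q powi k) + of_int k * s1 k)" for k
  proof (cases "k = 0")
    case True
    then show ?thesis by (simp add: li1_def)
  next
    case False
    then show ?thesis using infsumI[OF row[OF False]] by (simp add: T_def)
  qed
  have "(T has_sum (- \<beta>)\<^sup>2) UNIV"
    unfolding T_def by (rule has_sum_int_square[OF nu u])
  moreover have "((\<lambda>k. if k = (0::int) then T 0 else 0) has_sum T 0) UNIV"
    by (rule has_sum_finite_neutralI[where B = "{0}"]) auto
  ultimately have "((\<lambda>k. T k - (if k = 0 then T 0 else 0) - 2 * - \<beta> * li1 (q powi k)) has_sum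
     ((- \<beta>)\<^sup>2 - T 0 - 2 * - \<beta> * \<alpha>)) UNIV"
    by (intro has_sum_diff has_sum_cmult_right has_sum_\<alpha>)
  moreover have "T k - (if k = 0 then T 0 else 0) - 2 * - \<beta> * li1 (q powi k) = of_int k * s1 k" for k
    using T[of k] by simp
  moreover have "T 0 = (\<Sum>\<^sub>\<infinity>n. (li1 (- 1 * q powi n))\<^sup>2)" by (simp add: T_def u_def power2_eq_square)
  ultimately show ?thesis by simp
qed

text \<open>The same square for x_n = q^n. Now a diagonal k /= 0 meets the pole at n = 0 and at n =
  -k, and at each the partial fraction is off by half of li3(q^k). By \<open>li3_eq\<close> these
  defects add up to 6 \<open>T 0\<close> + \<alpha>, which against the main diagonal
  \<open>T 0\<close> leaves the coefficient 5. The sum of k \<open>s1 k\<close> is the one from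
  \<open>has_sum_s1\<close>.\<close>

lemma \<alpha>_squared:
  "\<alpha>\<^sup>2 = 5 * (\<Sum>\<^sub>\<infinity>n. (li1 (q powi n))\<^sup>2) + \<alpha> - (\<beta>\<^sup>2 - (\<Sum>\<^sub>\<infinity>n. (li1 (- 1 * q powi n))\<^sup>2) + 2 * \<beta> * \<alpha>)"
proof -
  define u where "u = (\<lambda>n. li1 (q powi n))"
  have u: "(u has_sum \<alpha>) UNIV" unfolding u_def by (rule has_sum_\<alpha>)
  have nu: "(\<lambda>n. norm (u n)) summable_on UNIV" unfolding u_def using norm_summable_li1[of 1] by simp
  \<comment> \<open>With the value \<open>1/2\<close> at the pole, \<open>h\<close> keeps the symmetry \<open>h (-n) = 1 - h n\<close>.\<close>
  define h where "h = (\<lambda>n. if n = 0 then 1/2 else g n)"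
  have h: "(\<lambda>n. h n - (if n > 0 then 1 else 0)) summable_on UNIV"
  proof -
    have "((\<lambda>n. if n = (0::int) then 1/2 else 0 :: complex) has_sum (1/2)) UNIV"
      by (rule has_sum_finite_neutralI[where B = "{0}"]) auto
    then have "(\<lambda>n. (of_int n ^ 0 * (g n - (if n > 0 then 1 else 0))) + (if n = 0 then 1/2 else 0)) summable_on UNIV"
      by (intro summable_on_add summable_kern_step has_sum_imp_summable) auto
    moreover have "(\<lambda>n. (of_int n ^ 0 * (g n - (if n > 0 then 1 else 0))) + (if n = 0 then 1/2 else 0)) =
       (\<lambda>n. h n - (if n > 0 then 1 else 0))"
      by (auto simp: h_def fun_eq_iff kern_def)
    ultimately show ?thesis by simp
  qed
  have row: "((\<lambda>n. u n * u (n + k)) has_sum (2 * \<alpha> * u k + of_int k * s1 k - 2 * (3 * (u k)\<^sup>2 + u k / 2))) UNIV"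
    if "k \<noteq> 0" for k
  proof -
    \<comment> \<open>Half of li3(q^k), by \<open>li3_eq\<close>: the amount by which the partial
      fraction fails when one factor sits at the pole and counts as 0.\<close>
    define c where "c = 3 * (u k)\<^sup>2 + u k / 2"
    have sym: "u (- k) = u k" "g (- k) = 1 - g k"
      using li1_even[of 1 k] kern_minus[of 1 k] g_defined[OF that] by (auto simp: u_def)
    have pole: "u k * u k - s1 k * (1 / 2 - g k) - c = 0"
    proof -
      define Q where "Q = q powi k"
      have "1 - Q \<noteq> 0" using g_defined[OF that] by (simp add: Q_def)
      then show ?thesis unfolding c_def u_def s1_def kern_def Q_def[symmetric] li1_def
        by (simp add: divide_simps power2_eq_square power3_eq_cube) algebra
    qed
    have "u n * u (n + k) = u k * (u n + u (n + k)) - s1 k * (h n - h (n + k)) -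
        (if n \<in> {0, - k} then c else 0)" for n
    proof -
      consider "n = 0" | "n = - k" | "n \<noteq> 0" "n + k \<noteq> 0" by linarith
      then show ?thesis
      proof cases
        case 1
        then show ?thesis using pole that by (simp add: h_def u_def li1_def)
      next
        case 2
        have s: "s1 k * (h n - h (n + k)) = s1 k * (1 / 2 - g k)"
        proof -
          have a: "h n = 1 - g k" and b: "h (n + k) = 1 / 2" using 2 that sym by (simp_all add: h_def)
          show ?thesis unfolding a b by (simp add: algebra_simps)
        qed
        have u0: "u (n + k) = 0" and un: "u n = u k" using 2 sym by (simp_all add: u_def li1_def)
        show ?thesis unfolding s u0 un using pole 2 by simp
      next
        case 3
        have "q powi n * q powi k = q powi (n + k)"
          using q_nonzero by (simp add: power_int_add)
        moreover have "h n = 1 / (1 - q powi n)" "h (n + k) = 1 / (1 - q powi (n + k))"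
          using 3 by (simp_all add: h_def kern_def)
        moreover have "q powi n \<noteq> 1" "q powi k \<noteq> 1" "q powi (n + k) \<noteq> 1"
          using g_defined[OF that] g_defined[OF 3(1)] g_defined[OF 3(2)] by simp_all
        moreover have "n \<notin> {0, - k}" using 3 by auto
        ultimately show ?thesis
          using li1_mult[of "q powi n" "q powi k"] by (simp add: u_def s1_def)
      qed
    qed
    moreover have "((\<lambda>n. if n \<in> {0, - k} then c else 0) has_sum (2 * c)) UNIV"
      by (rule has_sum_finite_neutralI[where B = "{0, - k}"]) (use that in auto)
    note has_sum_diff[OF has_sum_cross[OF u h, of "u k" k "s1 k"] this]
    ultimately show ?thesis by (simp add: c_def)
  qed
  define T where "T = (\<lambda>k. \<Sum>\<^sub>\<infinity>n. u n * u (n + k))"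
  have u0: "u 0 = 0" by (simp add: u_def li1_def)
  have T: "T k = (if k = 0 then T 0 else 0) + (2 * \<alpha> * u k + of_int k * s1 k - 2 * (3 * (u k)\<^sup>2 + u k / 2))" for k
  proof (cases "k = 0")
    case False
    then show ?thesis using infsumI[OF row[OF False]] by (simp add: T_def)
  qed (simp add: u0)
  have sq: "((\<lambda>k. (u k)\<^sup>2) has_sum T 0) UNIV"
    using has_sum_int_square(2)[OF nu u, of 0] by (simp add: T_def power2_eq_square)
  have "((\<lambda>k. if k = (0::int) then T 0 else 0) has_sum T 0) UNIV"
    by (rule has_sum_finite_neutralI[where B = "{0}"]) auto
  then have "((\<lambda>k. (if k = 0 then T 0 else 0) + (2 * \<alpha> * u k + of_int k * s1 k - 2 * (3 * (u k)\<^sup>2 + u k / 2))) has_sum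
      (T 0 + (2 * \<alpha> * \<alpha> + (\<beta>\<^sup>2 - (\<Sum>\<^sub>\<infinity>n. (li1 (- 1 * q powi n))\<^sup>2) + 2 * \<beta> * \<alpha>) - 2 * (3 * T 0 + \<alpha> / 2)))) UNIV"
    unfolding divide_inverse
    by (intro has_sum_diff has_sum_add has_sum_cmult_right has_sum_cmult_left has_sum_s1 sq u)
  moreover have "(T has_sum \<alpha>\<^sup>2) UNIV"
    unfolding T_def by (rule has_sum_int_square[OF nu u])
  ultimately have "\<alpha>\<^sup>2 = T 0 + (2 * \<alpha> * \<alpha> + (\<beta>\<^sup>2 - (\<Sum>\<^sub>\<infinity>n. (li1 (- 1 * q powi n))\<^sup>2) + 2 * \<beta> * \<alpha>) - 2 * (3 * T 0 + \<alpha> / 2))"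
    using T has_sum_unique by (metis (no_types, lifting) ext)
  moreover have "T 0 = (\<Sum>\<^sub>\<infinity>n. (li1 (q powi n))\<^sup>2)" using infsumI[OF sq] by (simp add: u_def)
  ultimately show ?thesis by (simp add: power2_eq_square) (simp add: algebra_simps)
qed

end

section \<open>Derivatives of the theta function\<close>

text \<open>Iterated \<open>deriv\<close> at one point depends on a neighbourhood, so the explicit
  chain F is required on an open set.\<close>

lemma higher_deriv_chain:
  fixes F :: "nat \<Rightarrow> complex \<Rightarrow> complex"
  assumes "open S" "\<And>n z. n < N \<Longrightarrow> z \<in> S \<Longrightarrow> (F n has_field_derivative F (Suc n) z) (at z)"
    and "n \<le> N" "z \<in> S"
  shows "(deriv ^^ n) (F 0) z = F n z"
  using assms(3,4)
proof (induction n arbitrary: z)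
  case (Suc n)
  have "(F n has_field_derivative F (Suc n) z) (at z)" using assms(2) Suc.prems by simp
  then have "((deriv ^^ n) (F 0) has_field_derivative F (Suc n) z) (at z)"
    by (rule has_field_derivative_transform_within_open[OF _ assms(1) Suc.prems(2)])
      (use Suc in auto)
  then show ?case by (simp add: DERIV_imp_deriv)
qed simp

text \<open>Expanding leaves seven monomials, one for each nonempty subset of the three factors, and
  each is at most t because t <= 1.\<close>

lemma norm_prod3_minus_1_le:
  fixes a b_bounds c :: complex
  assumes "norm a \<le> t" "norm b \<le> t" "norm c \<le> t" "t \<le> 1"
  shows "norm ((1 - a) * (1 - b) * (1 - c) - 1) \<le> 7 * t"
proof -
  have t: "0 \<le> t" using assms(1) norm_ge_zero order_trans by blast
  have ab: "norm (a * b) \<le> t * t" and ac: "norm (a * c) \<le> t * t" and bc: "norm (b * c) \<le> t * t"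
    unfolding norm_mult using assms t by (auto intro!: mult_mono)
  have abc: "norm (a * b * c) \<le> t * t * t"
    unfolding norm_mult using assms t by (intro mult_mono) auto
  have "(1 - a) * (1 - b) * (1 - c) - 1 = (a * b + a * c + b * c) - (a + b + c) - a * b * c"
    by (simp add: algebra_simps)
  also have "norm \<dots> \<le> norm (a * b) + norm (a * c) + norm (b * c) + (norm a + norm b + norm c) + norm (a * b * c)"
    by (intro norm_triangle_le_diff norm_triangle_le add_mono order_refl)
  also have "\<dots> \<le> 3 * (t * t) + 3 * t + t * t * t" using assms ab ac bc abc by linarith
  also have "t * t * t \<le> t * 1 * 1" using assms t by (intro mult_mono) auto
  also have "t * t \<le> t * 1" using assms t by (intro mult_mono) auto
  finally show ?thesis by simp
qed

text \<open>The two instances are \<open>x0 = 0\<close>, \<open>\<epsilon> = 1\<close> and \<open>x0 = 1/2\<close>, \<open>\<epsilon> = -1\<close>.\<close>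

locale theta_point =
  fixes \<tau> :: complex and x0 :: real and \<epsilon> :: complex
  assumes Im_pos: "Im \<tau> > 0"
    and \<epsilon>_def: "exp (2 * of_real pi * \<i> * of_real x0) = \<epsilon>" and \<epsilon>_square: "\<epsilon> * \<epsilon> = 1"
begin

abbreviation q :: complex where "q \<equiv> q_param \<tau>"
abbreviation z0 :: complex where "z0 \<equiv> of_real x0"

text \<open>The square root of |q|. On the disc \<open>S\<close> both exponentials are at most 1/b,
  so half of the decay of q remains available.\<close>

definition b :: real where "b = exp (- pi * Im \<tau>)"
definition w :: complex where "w = 2 * of_real pi * \<i>"
definition u :: "nat \<Rightarrow> complex \<Rightarrow> complex" where "u k z = exp (w * z) * q ^ Suc k"
definition v :: "nat \<Rightarrow> complex \<Rightarrow> complex" where "v k z = exp (- (w * z)) * q ^ Suc k"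
definition factor :: "nat \<Rightarrow> complex \<Rightarrow> complex" where
  "factor k z = (1 - q ^ Suc k) * (1 - u k z) * (1 - v k z)"
text \<open>The zeros of the factors have imaginary part of modulus at least Im \<tau>. Half that
  radius about the real centre keeps the product free of zeros with uniform bounds.\<close>

definition S :: "complex set" where "S = cball z0 (Im \<tau> / 2)"
definition T :: "complex set" where "T = ball z0 (Im \<tau> / 2)"

lemma disc_facts: "open T" "z0 \<in> T" "T \<subseteq> S" using Im_pos by (auto simp: S_def T_def)

lemma b_bounds: "0 < b" "b < 1" using Im_pos by (auto simp: b_def)

lemma norm_q: "norm q = b\<^sup>2"
  by (simp add: q_param_def b_def flip: exp_double)

lemma norm_uv_le:
  assumes "z \<in> S"
  shows "norm (u k z) \<le> b ^ Suc k" "norm (v k z) \<le> b ^ Suc k" "norm (q ^ Suc k) \<le> b ^ Suc k"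
proof -
  have "\<bar>Im (z - z0)\<bar> \<le> Im \<tau> / 2"
    using assms abs_Im_le_cmod[of "z - z0"] by (simp add: S_def dist_norm norm_minus_commute)
  then have Im: "\<bar>Im z\<bar> \<le> Im \<tau> / 2" by simp
  have b_inverse: "1 / b = exp (pi * Im \<tau>)" by (simp add: b_def exp_minus inverse_eq_divide)
  have e: "norm (exp (w * z)) \<le> 1 / b" "norm (exp (- (w * z))) \<le> 1 / b"
  proof -
    have "- (2 * Im z) \<le> Im \<tau>" "2 * Im z \<le> Im \<tau>" using Im by linarith+
    from mult_left_mono[OF this(1), of pi] mult_left_mono[OF this(2), of pi]
    have "- (2 * pi * Im z) \<le> pi * Im \<tau>" "2 * pi * Im z \<le> pi * Im \<tau>" by (simp_all add: mult_ac)
    then show "norm (exp (w * z)) \<le> 1 / b" "norm (exp (- (w * z))) \<le> 1 / b"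
      unfolding b_inverse by (simp_all add: w_def)
  qed
  have qk: "norm (q ^ Suc k) = b * b ^ Suc k * b ^ k"
    unfolding norm_power norm_q by (simp add: power2_eq_square power_mult_distrib)
  have "b * b ^ Suc k * b ^ k \<le> b * b ^ Suc k * 1"
    using b_bounds by (intro mult_left_mono power_le_one) auto
  \<comment> \<open>The extra factor b is kept to cancel the bound 1/b of the exponentials.\<close>
  then have qk': "norm (q ^ Suc k) \<le> b * b ^ Suc k" using qk by simp
  have "norm (u k z) \<le> 1 / b * (b * b ^ Suc k)"
    unfolding u_def norm_mult using e qk' b_bounds by (intro mult_mono) auto
  then show "norm (u k z) \<le> b ^ Suc k" using b_bounds by simp
  have "norm (v k z) \<le> 1 / b * (b * b ^ Suc k)"
    unfolding v_def norm_mult using e qk' b_bounds by (intro mult_mono) auto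
  then show "norm (v k z) \<le> b ^ Suc k" using b_bounds by simp
  have "b * b ^ Suc k \<le> 1 * b ^ Suc k" using b_bounds by (intro mult_right_mono) auto
  then show "norm (q ^ Suc k) \<le> b ^ Suc k" using qk' by simp
qed

lemma pow_le_b: "b ^ Suc k \<le> b" using b_bounds power_decreasing[of 1 "Suc k" b] by simp

lemma norm_one_minus_ge:
  fixes x :: complex
  assumes "norm x \<le> b ^ Suc k"
  shows "1 - b \<le> norm (1 - x)" "x \<noteq> 1"
proof -
  show 1: "1 - b \<le> norm (1 - x)"
    using norm_triangle_ineq2[of 1 x] assms pow_le_b[of k] by simp
  show "x \<noteq> 1" using 1 b_bounds by auto
qed

lemma uv_ne_1: "z \<in> S \<Longrightarrow> u k z \<noteq> 1" "z \<in> S \<Longrightarrow> v k z \<noteq> 1" "q ^ Suc k \<noteq> 1"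
  using norm_one_minus_ge(2) norm_uv_le disc_facts by blast+

lemma factor_nonzero: "z \<in> S \<Longrightarrow> factor k z \<noteq> 0"
  using uv_ne_1 by (simp add: factor_def)

lemma norm_factor_minus_1_le: "z \<in> S \<Longrightarrow> norm (factor k z - 1) \<le> 7 * b ^ Suc k"
  unfolding factor_def using order_trans[OF pow_le_b[of k] less_imp_le[OF b_bounds(2)]]
  by (intro norm_prod3_minus_1_le norm_uv_le)

section \<open>The infinite product and its logarithmic derivative\<close>

lemma summable_b: "summable (\<lambda>k. C * b ^ Suc k)"
  using b_bounds by (intro summable_mult) (simp add: summable_mult summable_geometric)

text \<open>The sine is left out because it vanishes at 0, whereas P has no zeros on
  \<open>S\<close> and so has a logarithmic derivative at both base points.\<close>

definition P :: "complex \<Rightarrow> complex" where "P z = (\<Prod>k. factor k z)"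

lemma convergent_factor: "z \<in> S \<Longrightarrow> convergent_prod (\<lambda>k. factor k z)"
  by (intro abs_convergent_prod_imp_convergent_prod summable_imp_abs_convergent_prod
      summable_comparison_test'[OF summable_b[of 7]]) (use norm_factor_minus_1_le in auto)

lemma u_deriv [derivative_intros]:
  "(u k has_field_derivative w * u k z) (at z)" "(v k has_field_derivative - w * v k z) (at z)"
  unfolding u_def v_def by (auto intro!: derivative_eq_intros)

lemma uv_holomorphic [holomorphic_intros]: "u k holomorphic_on A" "v k holomorphic_on A"
  unfolding u_def v_def by (auto intro!: holomorphic_intros)

lemma factor_holomorphic: "factor k holomorphic_on A"
  unfolding factor_def by (auto intro!: holomorphic_intros)

lemma uniform_limit_P: "uniform_limit S (\<lambda>n z. \<Prod>k<n. factor k z) P sequentially"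
proof -
  have "uniformly_convergent_on S (\<lambda>N z. \<Prod>k<N. factor k z)"
  proof (rule uniformly_convergent_on_prod')
    show "uniformly_convergent_on S (\<lambda>N z. \<Sum>n<N. norm (factor n z - 1))"
      by (rule Weierstrass_m_test'[OF _ summable_b[of 7]]) (use norm_factor_minus_1_le in auto)
  qed (auto simp: S_def intro!: holomorphic_on_imp_continuous_on factor_holomorphic)
  then obtain l where l: "uniform_limit S (\<lambda>n z. \<Prod>k<n. factor k z) l sequentially"
    unfolding uniformly_convergent_on_def by blast
  have "l z = P z" if "z \<in> S" for z
  proof -
    have "(\<lambda>n. \<Prod>k<n. factor k z) \<longlonglongrightarrow> l z" using tendsto_uniform_limitI[OF l that] .
    moreover have "(\<lambda>n. \<Prod>k<n. factor k z) \<longlonglongrightarrow> P z"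
      using convergent_prod_LIMSEQ[OF convergent_factor[OF that]]
      unfolding P_def by (simp add: LIMSEQ_lessThan_iff_atMost)
    ultimately show ?thesis by (rule LIMSEQ_unique)
  qed
  then show ?thesis using l by (metis uniform_limit_cong')
qed

lemma P_nonzero: "z \<in> S \<Longrightarrow> P z \<noteq> 0"
  unfolding P_def by (intro prodinf_nonzero convergent_factor factor_nonzero)

lemma P_holomorphic: "P holomorphic_on T"
proof -
  have "\<forall>\<^sub>F n in sequentially. continuous_on S (\<lambda>z. \<Prod>k<n. factor k z) \<and> (\<lambda>z. \<Prod>k<n. factor k z) holomorphic_on T"
    by (intro always_eventually allI conjI holomorphic_on_imp_continuous_on holomorphic_on_prod factor_holomorphic)
  then show ?thesis
    using holomorphic_uniform_limit[of z0 "Im \<tau> / 2" "\<lambda>n z. \<Prod>k<n. factor k z" sequentially P] uniform_limit_P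
    unfolding S_def T_def by (metis sequentially_bot)
qed

text \<open>\<open>M k 0\<close> is the logarithmic derivative of \<open>factor k\<close>, and the
  next three entries are its derivatives. Each differentiation raises the order of the
  polylogarithm; as u and v have opposite exponents, sums and differences alternate.\<close>

definition M :: "nat \<Rightarrow> nat \<Rightarrow> complex \<Rightarrow> complex" where
  "M k n = (\<lambda>z. case n of
     0 \<Rightarrow> w * (v k z / (1 - v k z) - u k z / (1 - u k z))
   | Suc 0 \<Rightarrow> - (w ^ 2) * (li1 (u k z) + li1 (v k z))
   | Suc (Suc 0) \<Rightarrow> - (w ^ 3) * (li2 (u k z) - li2 (v k z))
   | _ \<Rightarrow> - (w ^ 4) * (li3 (u k z) + li3 (v k z)))"

lemma M_deriv:
  assumes "n < 3" "z \<in> S"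
  shows "(M k n has_field_derivative M k (Suc n) z) (at z)"
proof -
  have nz: "1 - u k z \<noteq> 0" "1 - v k z \<noteq> 0" using uv_ne_1 assms(2) by auto
  define U V where "U = u k z" and "V = v k z"
  note nz' = nz[folded U_def V_def]
  have d0: "((\<lambda>x. x / (1 - x)) has_field_derivative 1 / (1 - x)\<^sup>2) (at x)"
    and d1: "(li1 has_field_derivative (1 + x) / (1 - x) ^ 3) (at x)"
    and d2: "(li2 has_field_derivative (1 + 4 * x + x\<^sup>2) / (1 - x) ^ 4) (at x)" if "1 - x \<noteq> 0" for x :: complex
    unfolding li1_def li2_def using that
    by (auto intro!: derivative_eq_intros simp: divide_simps power2_eq_square power3_eq_cube power4_eq_xxxx) algebra+
  note uu = u_deriv(1)[of k z] and vv = u_deriv(2)[of k z]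
  consider "n = 0" | "n = 1" | "n = 2" using assms by linarith
  then show ?thesis
  proof cases
    case 1
    have "((\<lambda>z. w * (v k z / (1 - v k z) - u k z / (1 - u k z))) has_field_derivative
        w * (1 / (1 - V)\<^sup>2 * (- w * V) - 1 / (1 - U)\<^sup>2 * (w * U))) (at z)"
      unfolding U_def V_def
      by (intro DERIV_cmult DERIV_diff DERIV_chain2[OF d0 uu] DERIV_chain2[OF d0 vv] nz)
    also have "w * (1 / (1 - V)\<^sup>2 * (- w * V) - 1 / (1 - U)\<^sup>2 * (w * U)) = - (w ^ 2) * (li1 U + li1 V)"
      by (simp add: li1_def power2_eq_square algebra_simps)
    finally show ?thesis by (simp add: 1 M_def U_def V_def)
  next
    case 2
    have "((\<lambda>z. - (w ^ 2) * (li1 (u k z) + li1 (v k z))) has_field_derivative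
        - (w ^ 2) * ((1 + U) / (1 - U) ^ 3 * (w * U) + (1 + V) / (1 - V) ^ 3 * (- w * V))) (at z)"
      unfolding U_def V_def
      by (intro DERIV_cmult DERIV_add DERIV_chain2[OF d1 uu] DERIV_chain2[OF d1 vv] nz)
    also have "- (w ^ 2) * ((1 + U) / (1 - U) ^ 3 * (w * U) + (1 + V) / (1 - V) ^ 3 * (- w * V)) = - (w ^ 3) * (li2 U - li2 V)"
    proof -
      have "- (w ^ 2) * (a * (w * U) + c * (- w * V)) = - (w ^ 3) * (a * U - c * V)" for a c
        by (simp add: power2_eq_square power3_eq_cube algebra_simps)
      moreover have "li2 x = (1 + x) / (1 - x) ^ 3 * x" for x by (simp add: li2_def)
      ultimately show ?thesis by (simp only:)
    qed
    finally show ?thesis by (simp add: 2 M_def U_def V_def numeral_2_eq_2)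
  next
    case 3
    have "((\<lambda>z. - (w ^ 3) * (li2 (u k z) - li2 (v k z))) has_field_derivative
        - (w ^ 3) * ((1 + 4 * U + U\<^sup>2) / (1 - U) ^ 4 * (w * U) - (1 + 4 * V + V\<^sup>2) / (1 - V) ^ 4 * (- w * V))) (at z)"
      unfolding U_def V_def
      by (intro DERIV_cmult DERIV_diff DERIV_chain2[OF d2 uu] DERIV_chain2[OF d2 vv] nz)
    also have "- (w ^ 3) * ((1 + 4 * U + U\<^sup>2) / (1 - U) ^ 4 * (w * U) - (1 + 4 * V + V\<^sup>2) / (1 - V) ^ 4 * (- w * V))
      = - (w ^ 4) * (li3 U + li3 V)"
    proof -
      have "- (w ^ 3) * (a * (w * U) - c * (- w * V)) = - (w ^ 4) * (a * U + c * V)" for a c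
        by (simp add: power3_eq_cube power4_eq_xxxx algebra_simps)
      moreover have "li3 x = (1 + 4 * x + x\<^sup>2) / (1 - x) ^ 4 * x" for x by (simp add: li3_def)
      ultimately show ?thesis by (simp only:)
    qed
    finally show ?thesis by (simp add: 3 M_def U_def V_def numeral_2_eq_2)
  qed
qed

lemma norm_M_le: "z \<in> S \<Longrightarrow> norm (M k 0 z) \<le> (2 * norm w / (1 - b)) * b ^ Suc k"
proof -
  assume z: "z \<in> S"
  have *: "norm (x / (1 - x)) \<le> b ^ Suc k / (1 - b)" if "norm x \<le> b ^ Suc k" for x :: complex
    unfolding norm_divide using norm_one_minus_ge[OF that] that b_bounds by (intro frac_le) auto
  have "norm (M k 0 z) \<le> norm w * (b ^ Suc k / (1 - b) + b ^ Suc k / (1 - b))"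
    unfolding M_def nat.case norm_mult
    by (intro mult_left_mono norm_triangle_le_diff add_mono * norm_uv_le z) auto
  then show ?thesis by (simp add: mult_ac)
qed

definition L :: "complex \<Rightarrow> complex" where "L z = (\<Sum>k. M k 0 z)"

lemma uniform_limit_L: "uniform_limit S (\<lambda>n z. \<Sum>k<n. M k 0 z) L sequentially"
  unfolding L_def by (rule Weierstrass_m_test[OF _ summable_b]) (rule norm_M_le)

lemma M_holomorphic: "M k 0 holomorphic_on T"
  unfolding holomorphic_on_open[OF disc_facts(1)] using M_deriv[of 0 _ k] disc_facts(3) by (meson subsetD zero_less_numeral)

lemma L_holomorphic: "L holomorphic_on T"
proof -
  have "continuous_on S (M k 0)" for k
    using M_deriv[of 0] by (intro continuous_at_imp_continuous_on ballI DERIV_isCont) auto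
  then have "\<forall>\<^sub>F n in sequentially. continuous_on S (\<lambda>z. \<Sum>k<n. M k 0 z) \<and> (\<lambda>z. \<Sum>k<n. M k 0 z) holomorphic_on T"
    by (intro always_eventually allI conjI continuous_on_sum holomorphic_on_sum M_holomorphic)
  then show ?thesis
    using holomorphic_uniform_limit[of z0 "Im \<tau> / 2" "\<lambda>n z. \<Sum>k<n. M k 0 z" sequentially L] uniform_limit_L
    unfolding S_def T_def by (metis sequentially_bot)
qed

text \<open>Locally uniform limits of holomorphic functions may be differentiated termwise, so only
  \<open>M k 0\<close> needs an estimate.\<close>

lemma L_deriv_sums:
  assumes "n \<le> 3"
  shows "(\<lambda>k. M k n z0) sums (deriv ^^ n) L z0"
proof -
  have "((\<lambda>N. (deriv ^^ n) (\<lambda>z. \<Sum>k<N. M k 0 z) z0) \<longlonglongrightarrow> (deriv ^^ n) L z0)"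
    by (rule higher_deriv_complex_uniform_limit[OF uniform_limit_on_subset[OF uniform_limit_L disc_facts(3)]])
      (auto intro!: always_eventually holomorphic_on_sum M_holomorphic disc_facts)
  moreover have "(deriv ^^ n) (\<lambda>z. \<Sum>k<N. M k 0 z) z0 = (\<Sum>k<N. M k n z0)" for N
    by (rule higher_deriv_chain[of T 3 "\<lambda>n z. \<Sum>k<N. M k n z" n z0])
      (use disc_facts assms in \<open>auto intro!: DERIV_sum M_deriv\<close>)
  ultimately show ?thesis by (simp add: sums_def)
qed

text \<open>Since \<epsilon> is its own inverse, u and v coincide at the base point. This makes
  every difference in M vanish there.\<close>

lemma uv_z0: "u k z0 = \<epsilon> * q ^ Suc k" "v k z0 = \<epsilon> * q ^ Suc k"
proof -
  have 1: "exp (w * z0) = \<epsilon>" using \<epsilon>_def by (simp add: w_def)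
  have "\<epsilon> \<noteq> 0" using \<epsilon>_square by auto
  then have "inverse \<epsilon> = \<epsilon>" using \<epsilon>_square by (simp add: inverse_unique)
  then have "exp (- (w * z0)) = \<epsilon>" by (simp add: exp_minus 1)
  then show "u k z0 = \<epsilon> * q ^ Suc k" "v k z0 = \<epsilon> * q ^ Suc k" using 1 by (simp_all add: u_def v_def)
qed

definition A1 :: complex where "A1 = (\<Sum>k. li1 (\<epsilon> * q ^ Suc k))"
definition A3 :: complex where "A3 = (\<Sum>k. li3 (\<epsilon> * q ^ Suc k))"

lemma w_nonzero: "w \<noteq> 0" by (simp add: w_def)

lemma L_z0:
  "L z0 = 0" "deriv L z0 = - 2 * w ^ 2 * A1" "(deriv ^^ 2) L z0 = 0" "(deriv ^^ 3) L z0 = - 2 * w ^ 4 * A3"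
proof -
  show "L z0 = 0" using L_deriv_sums[of 0] sums_unique[of "\<lambda>k. M k 0 z0"] by (simp add: M_def uv_z0)
  show "(deriv ^^ 2) L z0 = 0" using L_deriv_sums[of 2] sums_unique[of "\<lambda>k. M k 2 z0"] by (simp add: M_def uv_z0 numeral_2_eq_2)
  have "(\<lambda>k. (- 2 * w ^ 2) * li1 (\<epsilon> * q ^ Suc k)) sums deriv L z0"
    using L_deriv_sums[of 1] by (simp add: M_def uv_z0 mult_ac)
  \<comment> \<open>Division by a nonzero constant transfers convergence from the derivative series
    to the li1 series, without a separate bound.\<close>
  then have "(\<lambda>k. (- 2 * w ^ 2) * li1 (\<epsilon> * q ^ Suc k) / (- 2 * w ^ 2)) sums (deriv L z0 / (- 2 * w ^ 2))"
    by (rule sums_divide)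
  then have "A1 = deriv L z0 / (- 2 * w ^ 2)"
    unfolding A1_def using w_nonzero by (simp add: sums_iff)
  then show "deriv L z0 = - 2 * w ^ 2 * A1" using w_nonzero by simp
  have "(\<lambda>k. (- 2 * w ^ 4) * li3 (\<epsilon> * q ^ Suc k)) sums (deriv ^^ 3) L z0"
    using L_deriv_sums[of 3] by (simp add: M_def uv_z0 numeral_3_eq_3 mult_ac)
  then have "(\<lambda>k. (- 2 * w ^ 4) * li3 (\<epsilon> * q ^ Suc k) / (- 2 * w ^ 4)) sums ((deriv ^^ 3) L z0 / (- 2 * w ^ 4))"
    by (rule sums_divide)
  then have "A3 = (deriv ^^ 3) L z0 / (- 2 * w ^ 4)"
    unfolding A3_def using w_nonzero by (simp add: sums_iff)
  then show "(deriv ^^ 3) L z0 = - 2 * w ^ 4 * A3" using w_nonzero by simp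
qed

lemma P_deriv: "z \<in> T \<Longrightarrow> (P has_field_derivative P z * L z) (at z)"
proof -
  assume z: "z \<in> T"
  then have zS: "z \<in> S" using disc_facts by auto
  have "deriv (factor k) z / factor k z = M k 0 z" for k
  proof -
    have "(factor k has_field_derivative
        (1 - q ^ Suc k) * ((1 - u k z) * (w * v k z) - w * u k z * (1 - v k z))) (at z)"
      unfolding factor_def by (auto intro!: derivative_eq_intros simp: algebra_simps)
    then have d: "deriv (factor k) z = (1 - q ^ Suc k) * ((1 - u k z) * (w * v k z) - w * u k z * (1 - v k z))"
      by (rule DERIV_imp_deriv)
    have "1 - q ^ Suc k \<noteq> 0" "1 - u k z \<noteq> 0" "1 - v k z \<noteq> 0" using uv_ne_1 zS by simp_all
    then show ?thesis unfolding d M_def nat.case factor_def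
      by (simp add: divide_simps del: power_Suc) (simp add: algebra_simps)
  qed
  moreover have "(\<lambda>k. deriv (factor k) z / factor k z) sums (deriv P z / P z)"
    by (rule logderiv_prodinf_complex_uniform_limit[OF uniform_limit_on_subset[OF uniform_limit_P disc_facts(3)]
          factor_holomorphic P_nonzero disc_facts(1)]) (use z zS in auto)
  ultimately have "deriv P z / P z = L z" unfolding L_def by (simp add: sums_iff)
  then have "deriv P z = P z * L z" using P_nonzero[OF zS] by (simp add: field_simps)
  then show ?thesis using holomorphic_derivI[OF P_holomorphic disc_facts(1) z] by simp
qed

section \<open>Derivatives of the product and of theta at the base point\<close>

lemma P_z0:
  "(deriv ^^ 2) P z0 = P z0 * (- 2 * w ^ 2 * A1)"
  "(deriv ^^ 4) P z0 = P z0 * (3 * (- 2 * w ^ 2 * A1)\<^sup>2 - 2 * w ^ 4 * A3)"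
proof -
  define D where "D = (\<lambda>n. (deriv ^^ n) L)"
  have D: "(D n has_field_derivative D (Suc n) z) (at z)" if "z \<in> T" for n z
    unfolding D_def by (rule has_field_derivative_higher_deriv[OF L_holomorphic disc_facts(1) that, unfolded funpow.simps comp_def] |
      rule has_field_derivative_higher_deriv[OF L_holomorphic disc_facts(1) that])
  have P: "(P has_field_derivative P z * D 0 z) (at z)" if "z \<in> T" for z
    using P_deriv[OF that] by (simp add: D_def)
  \<comment> \<open>From P' = P L the n-th derivative is P times the complete Bell polynomial in L
    and its derivatives. At the base point L and L'' vanish, leaving L' for n = 2 and 3 L'^2 + L'''
    for n = 4.\<close>
  define F where "F = (\<lambda>n z. case n of 0 \<Rightarrow> P z | Suc 0 \<Rightarrow> P z * D 0 z | Suc (Suc 0) \<Rightarrow> P z * ((D 0 z)\<^sup>2 + D 1 z)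
    | Suc (Suc (Suc 0)) \<Rightarrow> P z * ((D 0 z) ^ 3 + 3 * D 0 z * D 1 z + D 2 z)
    | _ \<Rightarrow> P z * ((D 0 z) ^ 4 + 6 * (D 0 z)\<^sup>2 * D 1 z + 3 * (D 1 z)\<^sup>2 + 4 * D 0 z * D 2 z + D 3 z))"
  have "(F n has_field_derivative F (Suc n) z) (at z)" if n: "n < 4" and z: "z \<in> T" for n z
  proof -
    have d: "(D 0 has_field_derivative D 1 z) (at z)" "(D 1 has_field_derivative D 2 z) (at z)"
      "(D 2 has_field_derivative D 3 z) (at z)"
      using D[OF z, of 0] D[OF z, of 1] D[OF z, of 2] by (simp_all add: numeral_2_eq_2 numeral_3_eq_3)
    consider "n = 0" | "n = 1" | "n = 2" | "n = 3" using n by linarith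
    then show ?thesis
    proof cases
      case 1 then show ?thesis using P[OF z] by (simp add: F_def)
    next
      case 2
      have "((\<lambda>z. P z * D 0 z) has_field_derivative P z * ((D 0 z)\<^sup>2 + D 1 z)) (at z)"
        by (auto intro!: derivative_eq_intros d P[OF z] simp: algebra_simps power2_eq_square)
      then show ?thesis by (simp add: F_def 2)
    next
      case 3
      have "((\<lambda>z. P z * ((D 0 z)\<^sup>2 + D 1 z)) has_field_derivative P z * ((D 0 z) ^ 3 + 3 * D 0 z * D 1 z + D 2 z)) (at z)"
        by (rule DERIV_cong, (rule derivative_intros d P[OF z])+) (simp add: algebra_simps power2_eq_square power3_eq_cube)
      then show ?thesis by (simp add: F_def 3 numeral_2_eq_2)
    next
      case 4
      have "((\<lambda>z. P z * ((D 0 z) ^ 3 + 3 * D 0 z * D 1 z + D 2 z)) has_field_derivative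
        P z * ((D 0 z) ^ 4 + 6 * (D 0 z)\<^sup>2 * D 1 z + 3 * (D 1 z)\<^sup>2 + 4 * D 0 z * D 2 z + D 3 z)) (at z)"
        by (rule DERIV_cong, (rule derivative_intros d P[OF z])+)
          (simp add: algebra_simps power2_eq_square power3_eq_cube power4_eq_xxxx)
      then show ?thesis by (simp add: F_def 4 numeral_3_eq_3)
    qed
  qed
  then have "(deriv ^^ n) (F 0) z0 = F n z0" if "n \<le> 4" for n
    using higher_deriv_chain[OF disc_facts(1), of 4 F n z0] that disc_facts by blast
  moreover have "F 0 = P" by (simp add: F_def)
  moreover have "D 0 z0 = 0" "D 1 z0 = - 2 * w ^ 2 * A1" "D 2 z0 = 0" "D 3 z0 = - 2 * w ^ 4 * A3"
    using L_z0 by (simp_all add: D_def)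
  moreover have "F 2 z0 = P z0 * ((D 0 z0)\<^sup>2 + D 1 z0)"
    by (simp add: F_def numeral_2_eq_2)
  moreover have "F 4 z0 = P z0 * ((D 0 z0) ^ 4 + 6 * (D 0 z0)\<^sup>2 * D 1 z0 + 3 * (D 1 z0)\<^sup>2 + 4 * D 0 z0 * D 2 z0 + D 3 z0)"
  proof -
    have "F (Suc (Suc (Suc (Suc 0)))) z0 = P z0 * ((D 0 z0) ^ 4 + 6 * (D 0 z0)\<^sup>2 * D 1 z0 + 3 * (D 1 z0)\<^sup>2 + 4 * D 0 z0 * D 2 z0 + D 3 z0)"
      by (simp only: F_def nat.case)
    then show ?thesis by (simp only: eval_nat_numeral BitM.simps One_nat_def)
  qed
  ultimately show "(deriv ^^ 2) P z0 = P z0 * (- 2 * w ^ 2 * A1)"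
    "(deriv ^^ 4) P z0 = P z0 * (3 * (- 2 * w ^ 2 * A1)\<^sup>2 - 2 * w ^ 4 * A3)"
    by simp_all
qed

text \<open>Closed form of the n-th derivative of sin(pi z).\<close>

definition sd :: "nat \<Rightarrow> complex \<Rightarrow> complex" where
  "sd n z = of_real pi ^ n * (if even n then (-1) ^ (n div 2) * sin (of_real pi * z) else (-1) ^ (n div 2) * cos (of_real pi * z))"

lemma jacobi_theta_eq: "jacobi_theta z \<tau> = 2 * exp (w * \<tau> / 8) * (sd 0 z * P z)"
  by (simp add: jacobi_theta_def sd_def P_def factor_def u_def v_def w_def)

lemma jacobi_theta_deriv_z0:
  "jacobi_theta_deriv n z0 \<tau> = 2 * exp (w * \<tau> / 8) *
     (\<Sum>i=0..n. of_nat (n choose i) * sd i z0 * (deriv ^^ (n - i)) P z0)"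
proof -
  have sd: "(sd n has_field_derivative sd (Suc n) z) (at z)" for n z
    unfolding sd_def by (auto intro!: derivative_eq_intros elim!: evenE oddE)
  have sd': "(deriv ^^ i) (sd 0) z0 = sd i z0" for i
    using higher_deriv_chain[of UNIV i sd i z0] sd by simp
  have hol: "sd 0 holomorphic_on T"
    using sd unfolding holomorphic_on_open[OF disc_facts(1)] by blast
  have "jacobi_theta_deriv n z0 \<tau> = 2 * exp (w * \<tau> / 8) * (deriv ^^ n) (\<lambda>z. sd 0 z * P z) z0"
    unfolding jacobi_theta_deriv_def jacobi_theta_eq
    by (rule higher_deriv_cmult[OF _ _ disc_facts(1)]) (use disc_facts hol P_holomorphic in \<open>auto intro!: holomorphic_intros\<close>)
  also have "(deriv ^^ n) (\<lambda>z. sd 0 z * P z) z0 = (\<Sum>i=0..n. of_nat (n choose i) * sd i z0 * (deriv ^^ (n - i)) P z0)"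
    by (subst higher_deriv_mult[OF hol P_holomorphic disc_facts(1,2)]) (simp add: sd')
  finally show ?thesis .
qed

end

section \<open>The quadratic relation\<close>

lemma suminf_split_even_odd:
  fixes a :: "nat \<Rightarrow> complex"
  assumes "summable (\<lambda>n. norm (a n))"
  shows "suminf a = (\<Sum>i. a (2 * i)) + (\<Sum>i. a (Suc (2 * i)))"
proof -
  have "summable ((\<lambda>n. norm (a n)) \<circ> (\<lambda>i. 2 * i))"
    by (rule summable_reindex[OF assms]; simp add: inj_on_def)
  then have 0: "summable (\<lambda>i. norm (a (2 * i)))" by (simp only: o_def)
  have "summable ((\<lambda>n. norm (a n)) \<circ> (\<lambda>i. Suc (2 * i)))"
    by (rule summable_reindex[OF assms]; simp add: inj_on_def)
  then have 1: "summable (\<lambda>i. norm (a (Suc (2 * i))))" by (simp only: o_def)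
  have A: "(\<lambda>i. a (2 * i) + a (Suc (2 * i))) sums ((\<Sum>i. a (2 * i)) + (\<Sum>i. a (Suc (2 * i))))"
    by (rule sums_add[OF summable_sums[OF summable_norm_cancel[OF 0]] summable_sums[OF summable_norm_cancel[OF 1]]])
  have B: "(\<lambda>n. sum a {n * 2..<n * 2 + 2}) sums suminf a"
    by (rule sums_group[OF summable_sums[OF summable_norm_cancel[OF assms]]]) simp
  have C: "sum a {n * 2..<n * 2 + 2} = a (2 * n) + a (Suc (2 * n))" for n
  proof -
    have "{n * 2..<n * 2 + 2} = {2 * n, Suc (2 * n)}" by auto
    then show ?thesis by simp
  qed
  show ?thesis using sums_unique2[OF B[unfolded C] A] .
qed

section \<open>Lambert series over odd and even powers of q\<close>

context nome
begin

lemma summable_li1: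
  assumes "\<epsilon> * \<epsilon> = 1" "norm \<epsilon> = 1"
  shows "summable (\<lambda>k. norm (li1 (\<epsilon> * q ^ Suc k)))"
    and "(\<Sum>\<^sub>\<infinity>n. li1 (\<epsilon> * q powi n)) = li1 \<epsilon> + 2 * (\<Sum>k. li1 (\<epsilon> * q ^ Suc k))"
proof -
  have ev: "li1 (\<epsilon> * q powi (- n)) = li1 (\<epsilon> * q powi n)" for n by (rule li1_even[OF assms(1)])
  note * = infsum_even_int[OF norm_summable_li1[OF assms] ev, unfolded power_int_of_nat]
  show "summable (\<lambda>k. norm (li1 (\<epsilon> * q ^ Suc k)))" by (rule *(2))
  show "(\<Sum>\<^sub>\<infinity>n. li1 (\<epsilon> * q powi n)) = li1 \<epsilon> + 2 * (\<Sum>k. li1 (\<epsilon> * q ^ Suc k))"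
    using infsumI[OF *(1)] by simp
qed

text \<open>Reads \<open>li3_eq\<close> backwards: a sum of squares is (li3 - li1)/6, and folding
  the integers doubles it, hence the denominator 3.\<close>

lemma summable_li3:
  assumes "\<epsilon> * \<epsilon> = 1" "norm \<epsilon> = 1"
  shows "summable (\<lambda>k. norm (li3 (\<epsilon> * q ^ Suc k)))"
    and "(\<Sum>\<^sub>\<infinity>n. (li1 (\<epsilon> * q powi n))\<^sup>2) = (li1 \<epsilon>)\<^sup>2 +
      ((\<Sum>k. li3 (\<epsilon> * q ^ Suc k)) - (\<Sum>k. li1 (\<epsilon> * q ^ Suc k))) / 3"
proof -
  define u where "u = (\<lambda>n. li1 (\<epsilon> * q powi n))"
  have nu: "(\<lambda>n. norm (u n)) summable_on UNIV" unfolding u_def by (rule norm_summable_li1[OF assms])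
  then have "(u has_sum infsum u UNIV) UNIV" by (rule has_sum_infsum[OF abs_summable_summable])
  then have "(\<lambda>n. u n * u (n + 0)) summable_on UNIV" by (rule has_sum_int_square(2)[OF nu])
  then have "(\<lambda>n. (u n)\<^sup>2) summable_on UNIV" by (simp only: power2_eq_square add_0_right)
  from summable_on_iff_abs_summable_on_complex[THEN iffD1, OF this]
  have nu2: "(\<lambda>n. norm ((u n)\<^sup>2)) summable_on UNIV" .
  have ev: "(u (- n))\<^sup>2 = (u n)\<^sup>2" for n unfolding u_def li1_even[OF assms(1)] ..
  note * = infsum_even_int[of "\<lambda>n. (u n)\<^sup>2", OF nu2 ev]
  have ui: "u (int (Suc i)) = li1 (\<epsilon> * q ^ Suc i)" for i unfolding u_def power_int_of_nat ..
  have sq: "summable (\<lambda>i. norm ((li1 (\<epsilon> * q ^ Suc i))\<^sup>2))" using *(2) unfolding ui .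
  note s1 = summable_li1(1)[OF assms]
  have li3: "li3 (\<epsilon> * q ^ Suc i) = li1 (\<epsilon> * q ^ Suc i) + 6 * (li1 (\<epsilon> * q ^ Suc i))\<^sup>2" for i
    by (rule li3_eq)
  show "summable (\<lambda>k. norm (li3 (\<epsilon> * q ^ Suc k)))"
  proof (rule summable_comparison_test')
    show "summable (\<lambda>k. norm (li1 (\<epsilon> * q ^ Suc k)) + 6 * norm ((li1 (\<epsilon> * q ^ Suc k))\<^sup>2))"
      by (intro summable_add summable_mult s1 sq)
    show "norm (norm (li3 (\<epsilon> * q ^ Suc k))) \<le> norm (li1 (\<epsilon> * q ^ Suc k)) + 6 * norm ((li1 (\<epsilon> * q ^ Suc k))\<^sup>2)" for k
      unfolding li3 using norm_triangle_ineq[of "li1 (\<epsilon> * q ^ Suc k)" "6 * (li1 (\<epsilon> * q ^ Suc k))\<^sup>2"]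
      by (simp add: norm_mult)
  qed
  have "(\<Sum>k. li3 (\<epsilon> * q ^ Suc k)) = (\<Sum>k. li1 (\<epsilon> * q ^ Suc k)) + 6 * (\<Sum>k. (li1 (\<epsilon> * q ^ Suc k))\<^sup>2)"
    unfolding li3
    by (rule sums_unique[OF sums_add[OF summable_sums[OF summable_norm_cancel[OF s1]]
          sums_mult[OF summable_sums[OF summable_norm_cancel[OF sq]]]], symmetric])
  then show "(\<Sum>\<^sub>\<infinity>n. (li1 (\<epsilon> * q powi n))\<^sup>2) = (li1 \<epsilon>)\<^sup>2 +
      ((\<Sum>k. li3 (\<epsilon> * q ^ Suc k)) - (\<Sum>k. li1 (\<epsilon> * q ^ Suc k))) / 3"
    using infsumI[OF *(1)] unfolding ui by (simp add: u_def)
qed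

text \<open>Expanding 1/(1 - q^(2n)) geometrically gives the double series of n^k q^(n(2i+1)) with n
  >= 1; summing over n first produces the values at the odd powers of q.\<close>

lemma suminf_lambert_odd:
  fixes l :: "complex \<Rightarrow> complex"
  assumes l: "\<And>y. norm y < 1 \<Longrightarrow> (\<lambda>n. of_nat (Suc n) ^ k * y ^ Suc n) sums l y"
  shows "(\<Sum>n. of_nat (Suc n) ^ k * (q ^ Suc n / (1 - (q ^ Suc n)\<^sup>2))) = (\<Sum>i. l (q ^ Suc (2 * i)))"
proof -
  define F where "F = (\<lambda>n i. of_nat (Suc n) ^ k * q ^ (Suc n * Suc (2 * i)))"
  have "(\<lambda>n. real (Suc n) ^ k * r ^ Suc n) summable_on UNIV"
    using summable_power_geometric[of r k] r_less_1 summable_Suc_iff[of "\<lambda>n. real n ^ k * r ^ n"]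
    by (intro summable_nonneg_imp_summable_on) auto
  moreover have "(\<lambda>n. r ^ n) summable_on UNIV"
    using r_less_1 by (intro summable_nonneg_imp_summable_on summable_geometric) auto
  ultimately have "(\<lambda>(n, i). (real (Suc n) ^ k * r ^ Suc n) * r ^ i) summable_on UNIV"
    by (intro summable_on_product_nonneg) auto
  then have "(\<lambda>x. norm (case x of (n, i) \<Rightarrow> F n i)) summable_on UNIV"
  proof (rule Infinite_Sum.abs_summable_on_comparison_test')
    fix x :: "nat \<times> nat"
    obtain n i where x: "x = (n, i)" by (cases x)
    \<comment> \<open>The exponent (n+1)(2i+1) is at least (n+1) + i, which decouples the two
      indices.\<close>
    have "r ^ (Suc n * Suc (2 * i)) \<le> r ^ (Suc n + i)"
      using r_less_1 by (intro power_decreasing) auto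
    then have "real (Suc n) ^ k * r ^ (Suc n * Suc (2 * i)) \<le> real (Suc n) ^ k * r ^ (Suc n + i)"
      by (intro mult_left_mono) auto
    then show "norm (case x of (n, i) \<Rightarrow> F n i) \<le> (case x of (n, i) \<Rightarrow> (real (Suc n) ^ k * r ^ Suc n) * r ^ i)"
      unfolding x F_def prod.case norm_mult norm_power norm_of_nat power_add by (simp only: mult.assoc)
  qed
  then have F: "(\<lambda>(n, i). F n i) summable_on UNIV \<times> UNIV"
    unfolding UNIV_Times_UNIV by (rule abs_summable_summable)
  then obtain c where c: "((\<lambda>(n, i). F n i) has_sum c) (UNIV \<times> UNIV)"
    unfolding summable_on_def by blast
  have c': "((\<lambda>(i, n). F n i) has_sum c) (UNIV \<times> UNIV)"
    by (subst has_sum_swap) (use c in simp)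
  have 1: "(F n has_sum of_nat (Suc n) ^ k * (q ^ Suc n / (1 - (q ^ Suc n)\<^sup>2))) UNIV" for n
  proof -
    have sm: "F n summable_on UNIV" using summable_on_SigmaD1[OF F, of n] by simp
    have n1: "norm ((q ^ Suc n)\<^sup>2) < 1"
      using r_less_1 by (simp add: norm_power power_less_one_iff del: power_Suc)
    have "(\<lambda>i. of_nat (Suc n) ^ k * (q ^ Suc n * ((q ^ Suc n)\<^sup>2) ^ i)) sums
       (of_nat (Suc n) ^ k * (q ^ Suc n * (1 / (1 - (q ^ Suc n)\<^sup>2))))"
      by (intro sums_mult geometric_sums n1)
    moreover have "of_nat (Suc n) ^ k * (q ^ Suc n * ((q ^ Suc n)\<^sup>2) ^ i) = F n i" for i
      unfolding F_def by (simp only: power_mult power_add mult_Suc_right power_Suc)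
    ultimately have "F n sums (of_nat (Suc n) ^ k * (q ^ Suc n / (1 - (q ^ Suc n)\<^sup>2)))" by simp
    moreover have "F n sums infsum (F n) UNIV" using has_sum_imp_sums[OF has_sum_infsum[OF sm]] .
    ultimately have "infsum (F n) UNIV = of_nat (Suc n) ^ k * (q ^ Suc n / (1 - (q ^ Suc n)\<^sup>2))"
      by (metis sums_unique2)
    then show ?thesis using has_sum_infsum[OF sm] by simp
  qed
  have 2: "((\<lambda>n. F n i) has_sum l (q ^ Suc (2 * i))) UNIV" for i
  proof -
    have sm: "(\<lambda>n. F n i) summable_on UNIV"
      using summable_on_SigmaD1[of "\<lambda>i n. F n i" UNIV "\<lambda>_. UNIV" i] has_sum_imp_summable[OF c'] by simp
    have "norm (q ^ Suc (2 * i)) < 1"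
      unfolding norm_power using r_less_1 r_pos by (simp add: power_less_one_iff del: power_Suc)
    then have "(\<lambda>n. of_nat (Suc n) ^ k * (q ^ Suc (2 * i)) ^ Suc n) sums l (q ^ Suc (2 * i))" by (rule l)
    moreover have "of_nat (Suc n) ^ k * (q ^ Suc (2 * i)) ^ Suc n = F n i" for n
      unfolding F_def by (simp only: power_mult[symmetric] mult.commute)
    ultimately have "(\<lambda>n. F n i) sums l (q ^ Suc (2 * i))" by simp
    moreover have "(\<lambda>n. F n i) sums infsum (\<lambda>n. F n i) UNIV" using has_sum_imp_sums[OF has_sum_infsum[OF sm]] .
    ultimately have "infsum (\<lambda>n. F n i) UNIV = l (q ^ Suc (2 * i))" by (metis sums_unique2)
    then show ?thesis using has_sum_infsum[OF sm] by simp
  qed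
  have A: "((\<lambda>n. of_nat (Suc n) ^ k * (q ^ Suc n / (1 - (q ^ Suc n)\<^sup>2))) has_sum c) UNIV"
    by (rule has_sum_SigmaD[OF c]) (simp only: prod.case 1)
  have B: "((\<lambda>i. l (q ^ Suc (2 * i))) has_sum c) UNIV"
    by (rule has_sum_SigmaD[OF c']) (simp only: prod.case 2)
  show ?thesis
    by (rule trans[OF sums_unique[OF has_sum_imp_sums[OF A], symmetric] sums_unique[OF has_sum_imp_sums[OF B]]])
qed

text \<open>With X = q^m, g m - f m = 2X/(1-X^2). This 2 and the 2 from folding an even sum make the
  factor 4.\<close>

lemma \<gamma>_eq: "\<gamma> = 4 * (\<Sum>i. li1 (q ^ Suc (2 * i)))"
proof -
  define u where "u = (\<lambda>m. of_int m * (g m - f m))"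
  have u: "(u has_sum \<gamma>) UNIV" unfolding u_def by (rule has_sum_\<gamma>)
  have nu: "(\<lambda>m. norm (u m)) summable_on UNIV"
    using summable_on_iff_abs_summable_on_complex[of u UNIV] has_sum_imp_summable[OF u] by simp
  have ev: "u (- m) = u m" for m
  proof (cases "m = 0")
    case False
    then have 1: "g (- m) = 1 - g m" using kern_minus[of 1 m] g_defined[of m] by simp
    show ?thesis unfolding u_def 1 f_minus by (simp add: algebra_simps)
  qed simp
  have ui: "u (int (Suc i)) = 2 * (of_nat (Suc i) ^ 1 * (q ^ Suc i / (1 - (q ^ Suc i)\<^sup>2)))" for i
  proof -
    define X where "X = q ^ Suc i"
    have XI: "q powi int (Suc i) = X" unfolding X_def power_int_of_nat ..
    have nz: "1 - X \<noteq> 0" "1 + X \<noteq> 0"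
      using g_defined[of "int (Suc i)"] f_times[of "int (Suc i)"] unfolding XI by auto
    have "g (int (Suc i)) - f (int (Suc i)) = 1 / (1 - X) - 1 / (1 + X)" unfolding kern_def XI by simp
    also have "\<dots> = 2 * (X / ((1 - X) * (1 + X)))" using nz by (simp add: divide_simps)
    also have "(1 - X) * (1 + X) = 1 - X\<^sup>2" by (simp add: power2_eq_square algebra_simps)
    finally show ?thesis unfolding u_def X_def[symmetric] by simp
  qed
  have "\<gamma> = u 0 + 2 * (\<Sum>i. u (int (Suc i)))"
    using has_sum_unique[OF u infsum_even_int(1)[OF nu ev]] .
  also have "u 0 = 0" by (simp add: u_def)
  also have "(\<Sum>i. u (int (Suc i))) = 2 * (\<Sum>i. of_nat (Suc i) ^ 1 * (q ^ Suc i / (1 - (q ^ Suc i)\<^sup>2)))"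
  proof -
    have "summable (\<lambda>i. u (int (Suc i)))" using infsum_even_int(2)[OF nu ev] by (rule summable_norm_cancel)
    then have "summable (\<lambda>i. of_nat (Suc i) ^ 1 * (q ^ Suc i / (1 - (q ^ Suc i)\<^sup>2)))"
      unfolding ui by (rule summable_mult_D) simp
    then show ?thesis unfolding ui by (rule suminf_mult)
  qed
  also have "(\<Sum>i. of_nat (Suc i) ^ 1 * (q ^ Suc i / (1 - (q ^ Suc i)\<^sup>2))) = (\<Sum>i. li1 (q ^ Suc (2 * i)))"
    by (rule suminf_lambert_odd) (simp only: power_one_right sums_li(1))
  finally show ?thesis by simp
qed

text \<open>Both c^3 and X/(1-X^2) change sign under c -> -c, so the summand is even; here folding
  alone gives the factor 2.\<close>

lemma E_eq: "E = 2 * (\<Sum>i. li3 (q ^ Suc (2 * i)))"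
proof -
  define u where "u = (\<lambda>c. of_int c ^ 3 * (q powi c / (1 - q powi (2 * c))))"
  have u: "(u has_sum E) UNIV" unfolding u_def by (rule has_sum_E_single)
  have nu: "(\<lambda>m. norm (u m)) summable_on UNIV"
    using summable_on_iff_abs_summable_on_complex[of u UNIV] has_sum_imp_summable[OF u] by simp
  have q2: "q powi (2 * c) = (q powi c)\<^sup>2" for c
  proof -
    have "q powi (2 * c) = (q powi c) powi 2" using power_int_mult[of q c 2] by (simp only: mult.commute)
    then show ?thesis by simp
  qed
  have ev: "u (- c) = u c" for c
  proof (cases "c = 0")
    case False
    define X where "X = q powi c"
    have X: "X \<noteq> 0" "X\<^sup>2 \<noteq> 1"
      using q_nonzero g_defined[of "2 * c"] False unfolding q2 by (auto simp: X_def)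
    have "q powi (- c) / (1 - q powi (2 * - c)) = (1 / X) / (1 - (1 / X)\<^sup>2)"
      unfolding q2 by (simp add: X_def power_int_minus divide_inverse)
    also have "\<dots> = - (X / (1 - X\<^sup>2))"
      using X by (simp add: divide_simps power2_eq_square) (simp add: algebra_simps)
    finally show ?thesis unfolding u_def q2[of c] X_def[symmetric] by simp
  qed simp
  have ui: "u (int (Suc i)) = of_nat (Suc i) ^ 3 * (q ^ Suc i / (1 - (q ^ Suc i)\<^sup>2))" for i
    unfolding u_def q2 power_int_of_nat by simp
  have "E = u 0 + 2 * (\<Sum>i. u (int (Suc i)))"
    using has_sum_unique[OF u infsum_even_int(1)[OF nu ev]] .
  also have "u 0 = 0" by (simp add: u_def)
  also have "(\<Sum>i. u (int (Suc i))) = (\<Sum>i. li3 (q ^ Suc (2 * i)))"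
    unfolding ui by (rule suminf_lambert_odd) (rule sums_li(2))
  finally show ?thesis by simp
qed

text \<open>All constants of the theorem are polynomials in these four numbers (sums over odd and even powers of \<open>q\<close>).\<close>

definition so :: complex where "so = (\<Sum>i. li1 (q ^ Suc (2 * i)))"
definition se :: complex where "se = (\<Sum>i. li1 ((q ^ Suc i)\<^sup>2))"
definition ho :: complex where "ho = (\<Sum>i. li3 (q ^ Suc (2 * i)))"
definition he :: complex where "he = (\<Sum>i. li3 ((q ^ Suc i)\<^sup>2))"

lemma q_power_square_ne_1: "(q ^ Suc i)\<^sup>2 \<noteq> 1"
proof
  assume 1: "(q ^ Suc i)\<^sup>2 = 1"
  have "norm ((q ^ Suc i)\<^sup>2) < 1"
    using r_less_1 by (simp add: norm_power power_less_one_iff del: power_Suc)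
  then show False unfolding 1 by simp
qed

text \<open>For the sign +1 the exponents are split by parity. Duplication makes the two signed sums
  add up to 4 \<open>se\<close>, which determines the other one; for li3 the total is 16
  \<open>he\<close>.\<close>

lemma sum_li1:
  "(\<Sum>k. li1 (1 * q ^ Suc k)) = so + se" "(\<Sum>k. li1 (- 1 * q ^ Suc k)) = 3 * se - so"
proof -
  have 1: "summable (\<lambda>k. norm (li1 (q ^ Suc k)))" "summable (\<lambda>k. norm (li1 (- 1 * q ^ Suc k)))"
    using summable_li1(1)[of 1] summable_li1(1)[of "- 1"] by simp_all
  have ev: "q ^ Suc (Suc (2 * i)) = (q ^ Suc i)\<^sup>2" for i
  proof -
    have "Suc (Suc (2 * i)) = Suc i * 2" by simp
    then show ?thesis by (simp only: power_mult)
  qed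
  have s: "(\<Sum>k. li1 (q ^ Suc k)) = so + se"
    using suminf_split_even_odd[OF 1(1)] unfolding so_def se_def ev .
  then show "(\<Sum>k. li1 (1 * q ^ Suc k)) = so + se" by simp
  have "(\<Sum>k. li1 (q ^ Suc k)) + (\<Sum>k. li1 (- 1 * q ^ Suc k)) = (\<Sum>k. li1 (q ^ Suc k) + li1 (- 1 * q ^ Suc k))"
    by (rule suminf_add[OF summable_norm_cancel[OF 1(1)] summable_norm_cancel[OF 1(2)]])
  also have "\<dots> = (\<Sum>k. 4 * li1 ((q ^ Suc k)\<^sup>2))"
    by (simp only: mult_minus1 li1_duplicate[OF q_power_square_ne_1])
  also have "\<dots> = 4 * se" unfolding se_def
  proof (rule suminf_mult)
    have "summable ((\<lambda>k. norm (li1 (q ^ Suc k))) \<circ> (\<lambda>i. Suc (2 * i)))"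
      by (rule summable_reindex[OF 1(1)]; simp add: inj_on_def)
    then show "summable (\<lambda>k. li1 ((q ^ Suc k)\<^sup>2))"
      unfolding o_def ev by (rule summable_norm_cancel)
  qed
  finally show "(\<Sum>k. li1 (- 1 * q ^ Suc k)) = 3 * se - so" unfolding s by (simp add: algebra_simps)
qed

lemma sum_li3:
  "(\<Sum>k. li3 (1 * q ^ Suc k)) = ho + he" "(\<Sum>k. li3 (- 1 * q ^ Suc k)) = 15 * he - ho"
proof -
  have 1: "summable (\<lambda>k. norm (li3 (q ^ Suc k)))" "summable (\<lambda>k. norm (li3 (- 1 * q ^ Suc k)))"
    using summable_li3(1)[of 1] summable_li3(1)[of "- 1"] by simp_all
  have ev: "q ^ Suc (Suc (2 * i)) = (q ^ Suc i)\<^sup>2" for i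
  proof -
    have "Suc (Suc (2 * i)) = Suc i * 2" by simp
    then show ?thesis by (simp only: power_mult)
  qed
  have s: "(\<Sum>k. li3 (q ^ Suc k)) = ho + he"
    using suminf_split_even_odd[OF 1(1)] unfolding ho_def he_def ev .
  then show "(\<Sum>k. li3 (1 * q ^ Suc k)) = ho + he" by simp
  have "(\<Sum>k. li3 (q ^ Suc k)) + (\<Sum>k. li3 (- 1 * q ^ Suc k)) = (\<Sum>k. li3 (q ^ Suc k) + li3 (- 1 * q ^ Suc k))"
    by (rule suminf_add[OF summable_norm_cancel[OF 1(1)] summable_norm_cancel[OF 1(2)]])
  also have "\<dots> = (\<Sum>k. 16 * li3 ((q ^ Suc k)\<^sup>2))"
    by (simp only: mult_minus1 li3_duplicate[OF q_power_square_ne_1])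
  also have "\<dots> = 16 * he" unfolding he_def
  proof (rule suminf_mult)
    have "summable ((\<lambda>k. norm (li3 (q ^ Suc k))) \<circ> (\<lambda>i. Suc (2 * i)))"
      by (rule summable_reindex[OF 1(1)]; simp add: inj_on_def)
    then show "summable (\<lambda>k. li3 ((q ^ Suc k)\<^sup>2))"
      unfolding o_def ev by (rule summable_norm_cancel)
  qed
  finally show "(\<Sum>k. li3 (- 1 * q ^ Suc k)) = 15 * he - ho" unfolding s by (simp add: algebra_simps)
qed

lemma \<alpha>_eq: "\<alpha> = 2 * (so + se)"
proof -
  have "\<alpha> = (\<Sum>\<^sub>\<infinity>n. li1 (1 * q powi n))" unfolding \<alpha>_def by simp
  also have "\<dots> = li1 1 + 2 * (\<Sum>k. li1 (1 * q ^ Suc k))" by (rule summable_li1(2)) auto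
  finally show ?thesis unfolding sum_li1 by (simp add: li1_def)
qed

lemma \<beta>_eq: "\<beta> = 1 / 4 - 2 * (3 * se - so)"
proof -
  have "- \<beta> = (\<Sum>\<^sub>\<infinity>n. li1 (- 1 * q powi n))" using infsumI[OF has_sum_minus_\<beta>] by simp
  also have "\<dots> = li1 (- 1) + 2 * (\<Sum>k. li1 (- 1 * q ^ Suc k))" by (rule summable_li1(2)) auto
  finally have "- \<beta> = li1 (- 1) + 2 * (3 * se - so)" unfolding sum_li1 .
  moreover have "li1 (- 1) = - 1 / 4" by (simp add: li1_def)
  ultimately have "- \<beta> = - 1 / 4 + 2 * (3 * se - so)" by simp
  from arg_cong[OF this, of uminus]
  have "\<beta> = - (- 1 / 4 + 2 * (3 * se - so))" by (simp only: minus_minus)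
  then show ?thesis by simp
qed

text \<open>This is the classical expression of the square of a weight 2 Eisenstein series of level 2
  by weight 4 Eisenstein series; in \<open>(\<alpha> + \<beta>)\<^sup>2\<close> the non-modular sum
  of \<open>has_sum_s1\<close> cancels between \<open>\<alpha>\<^sup>2\<close> and \<open>\<beta>\<^sup>2 + 2 \<alpha> \<beta>\<close>.\<close>

lemma so_se_ho_he: "12 * (so - se)\<^sup>2 + (so - se) = ho + 5 * he"
proof -
  have p: "(\<Sum>\<^sub>\<infinity>n. (li1 (q powi n))\<^sup>2) = (ho + he - so - se) / 3"
    using summable_li3(2)[of 1] sum_li1(1) sum_li3(1) by (simp add: li1_def)
  have m: "(\<Sum>\<^sub>\<infinity>n. (li1 (- 1 * q powi n))\<^sup>2) = 1 / 16 + (15 * he - ho - 3 * se + so) / 3"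
    using summable_li3(2)[of "- 1"] sum_li1(2) sum_li3(2) by (simp add: li1_def power2_eq_square)
  \<comment> \<open>The quadratic terms of R form (\<alpha> + \<beta>)^2, and \<alpha> + \<beta> = 4
    (so - se) + 1/4. The factor 3/4 below turns the leading 16 into 12.\<close>
  define R where "R = \<alpha>\<^sup>2 - (5 * ((ho + he - so - se) / 3) + \<alpha> -
    (\<beta>\<^sup>2 - (1 / 16 + (15 * he - ho - 3 * se + so) / 3) + 2 * \<beta> * \<alpha>))"
  have "R = 0" using \<alpha>_squared unfolding p m R_def by simp
  moreover have "12 * (so - se)\<^sup>2 + (so - se) - (ho + 5 * he) = 3 / 4 * R"
    unfolding R_def \<alpha>_eq \<beta>_eq by (simp add: power2_eq_square field_simps)
  ultimately have "12 * (so - se)\<^sup>2 + (so - se) - (ho + 5 * he) = 0" by (simp only: mult_zero_right)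
  then show ?thesis by (simp only: right_minus_eq)
qed

end

section \<open>Comparison\<close>

lemma (in theta_point) nome_q: "nome q"
proof
  show "q \<noteq> 0" by (simp add: q_param_def)
  show "norm q < 1" unfolding norm_q using b_bounds by (simp add: power_less_one_iff)
qed

text \<open>Theta vanishes at 0, so theta'(0) is the normaliser. The even derivatives of the sine
  vanish there, hence in odd total order only even derivatives of P survive the Leibniz
  rule.\<close>

lemma theta_at_0:
  assumes "Im \<tau> > 0"
  defines "q \<equiv> q_param \<tau>" and "\<kappa> \<equiv> 2 * of_real pi * \<i>"
  defines "A \<equiv> \<Sum>k. li1 (1 * q ^ Suc k)" and "B \<equiv> \<Sum>k. li3 (1 * q ^ Suc k)"
  shows "jacobi_theta_deriv 1 0 \<tau> \<noteq> 0"
    "jacobi_theta_deriv 3 0 \<tau> = jacobi_theta_deriv 1 0 \<tau> * (\<kappa>\<^sup>2 * (1 / 4 - 6 * A))"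
    "jacobi_theta_deriv 5 0 \<tau> = jacobi_theta_deriv 1 0 \<tau> * (\<kappa> ^ 4 * (60 * A\<^sup>2 - 10 * B - 5 * A + 1 / 16))"
proof -
  interpret theta_point \<tau> 0 1
    by unfold_locales (use assms in auto)
  have w_eq: "theta_point.w = \<kappa>" by (simp add: \<kappa>_def w_def)
  have AB: "A1 = A" "A3 = B" by (simp_all add: A1_def A3_def A_def B_def q_def)
  define p where "p = complex_of_real pi"
  \<comment> \<open>Powers of pi from the sine become powers of \<kappa>; this is the origin of the
    constants 1/4 and 1/16.\<close>
  have w2: "\<kappa>\<^sup>2 = - 4 * p\<^sup>2" by (simp add: \<kappa>_def p_def power_mult_distrib)
  have w4: "\<kappa> ^ 4 = 16 * p ^ 4" by (simp add: \<kappa>_def p_def power_mult_distrib)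
  have sd: "sd 0 0 = 0" "sd 1 0 = p" "sd 2 0 = 0" "sd 3 0 = - (p ^ 3)" "sd 4 0 = 0" "sd 5 0 = p ^ 5"
    by (simp_all add: sd_def p_def)
  define K where "K = 2 * exp (\<kappa> * \<tau> / 8) * P 0"
  have K: "K \<noteq> 0" using P_nonzero[of 0] disc_facts by (auto simp: K_def)
  have D: "jacobi_theta_deriv n 0 \<tau> = 2 * exp (\<kappa> * \<tau> / 8) *
     (\<Sum>i=0..n. of_nat (n choose i) * sd i 0 * (deriv ^^ (n - i)) P 0)" for n
    using jacobi_theta_deriv_z0[of n] unfolding w_eq by simp
  have P2: "(deriv ^^ 2) P 0 = P 0 * (- 2 * \<kappa>\<^sup>2 * A)"
    and P4: "(deriv ^^ 4) P 0 = P 0 * (3 * (- 2 * \<kappa>\<^sup>2 * A)\<^sup>2 - 2 * \<kappa> ^ 4 * B)"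
    using P_z0 unfolding w_eq AB by simp_all
  have s1: "(\<Sum>i=0..1. h i) = h 0 + h 1" and s3: "(\<Sum>i=0..3. h i) = h 0 + h 1 + h 2 + h 3"
    and s5: "(\<Sum>i=0..5. h i) = h 0 + h 1 + h 2 + h 3 + h 4 + h 5" for h :: "nat \<Rightarrow> complex"
    by (simp_all add: eval_nat_numeral)
  have ch: "3 choose 3 = (1::nat)" "3 choose 1 = (3::nat)" "5 choose 1 = (5::nat)" "5 choose 3 = (10::nat)" "5 choose 5 = (1::nat)"
    by (simp_all add: eval_nat_numeral)
  have 1: "jacobi_theta_deriv 1 0 \<tau> = K * p"
    unfolding D s1 sd K_def by simp
  have "jacobi_theta_deriv 3 0 \<tau> = 2 * exp (\<kappa> * \<tau> / 8) * (3 * p * (deriv ^^ 2) P 0 - p ^ 3 * P 0)"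
    unfolding D s3 sd by (simp add: ch)
  also have "\<dots> = K * p * (\<kappa>\<^sup>2 * (1 / 4 - 6 * A))"
    unfolding P2 w2 K_def by (simp add: power2_eq_square power3_eq_cube algebra_simps)
  finally show "jacobi_theta_deriv 3 0 \<tau> = jacobi_theta_deriv 1 0 \<tau> * (\<kappa>\<^sup>2 * (1 / 4 - 6 * A))"
    unfolding 1 .
  have "jacobi_theta_deriv 5 0 \<tau> = 2 * exp (\<kappa> * \<tau> / 8) * (5 * p * (deriv ^^ 4) P 0 - 10 * p ^ 3 * (deriv ^^ 2) P 0 + p ^ 5 * P 0)"
    unfolding D s5 sd by (simp add: ch)
  also have "\<dots> = K * p * (\<kappa> ^ 4 * (60 * A\<^sup>2 - 10 * B - 5 * A + 1 / 16))"
    unfolding P2 P4 w2 w4 K_def by (simp add: eval_nat_numeral algebra_simps)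
  finally show "jacobi_theta_deriv 5 0 \<tau> = jacobi_theta_deriv 1 0 \<tau> * (\<kappa> ^ 4 * (60 * A\<^sup>2 - 10 * B - 5 * A + 1 / 16))"
    unfolding 1 .
  show "jacobi_theta_deriv 1 0 \<tau> \<noteq> 0" unfolding 1 using K by (simp add: p_def)
qed

text \<open>Here the odd derivatives of the sine vanish instead, so even total order again involves
  only even derivatives of P, and the value of theta itself serves as normaliser.\<close>

lemma theta_at_half:
  assumes "Im \<tau> > 0"
  defines "q \<equiv> q_param \<tau>" and "\<kappa> \<equiv> 2 * of_real pi * \<i>"
  defines "A \<equiv> \<Sum>k. li1 (- 1 * q ^ Suc k)" and "B \<equiv> \<Sum>k. li3 (- 1 * q ^ Suc k)"
  shows "jacobi_theta (1/2) \<tau> \<noteq> 0"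
    "jacobi_theta_deriv 2 (1/2) \<tau> = jacobi_theta (1/2) \<tau> * (\<kappa>\<^sup>2 * (1 / 4 - 2 * A))"
    "jacobi_theta_deriv 4 (1/2) \<tau> = jacobi_theta (1/2) \<tau> * (\<kappa> ^ 4 * (12 * A\<^sup>2 - 2 * B - 3 * A + 1 / 16))"
proof -
  have "exp (2 * complex_of_real pi * \<i> * complex_of_real (1 / 2)) = - 1"
    using exp_pi_i by (simp add: mult_ac)
  then interpret theta_point \<tau> "1/2" "- 1"
    by unfold_locales (use assms in auto)
  have w_eq: "theta_point.w = \<kappa>" by (simp add: \<kappa>_def w_def)
  have AB: "A1 = A" "A3 = B" by (simp_all add: A1_def A3_def A_def B_def q_def)
  define p where "p = complex_of_real pi"
  have w2: "\<kappa>\<^sup>2 = - 4 * p\<^sup>2" by (simp add: \<kappa>_def p_def power_mult_distrib)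
  have w4: "\<kappa> ^ 4 = 16 * p ^ 4" by (simp add: \<kappa>_def p_def power_mult_distrib)
  have z: "complex_of_real (1 / 2) = 1 / 2" by simp
  have "sin (complex_of_real pi * (1 / 2)) = of_real (sin (pi / 2))" "cos (complex_of_real pi * (1 / 2)) = of_real (cos (pi / 2))"
    unfolding sin_of_real[symmetric] cos_of_real[symmetric] by simp_all
  then have "sin (complex_of_real pi * (1 / 2)) = 1" "cos (complex_of_real pi * (1 / 2)) = 0"
    by simp_all
  then have sd: "sd 0 (1/2) = 1" "sd 1 (1/2) = 0" "sd 2 (1/2) = - p\<^sup>2" "sd 3 (1/2) = 0" "sd 4 (1/2) = p ^ 4"
    by (simp_all add: sd_def p_def)
  define K where "K = 2 * exp (\<kappa> * \<tau> / 8) * P (1/2)"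
  have K: "K \<noteq> 0" using P_nonzero[of "1/2"] disc_facts unfolding z by (auto simp: K_def)
  have D: "jacobi_theta_deriv n (1/2) \<tau> = 2 * exp (\<kappa> * \<tau> / 8) *
     (\<Sum>i=0..n. of_nat (n choose i) * sd i (1/2) * (deriv ^^ (n - i)) P (1/2))" for n
    using jacobi_theta_deriv_z0[of n] unfolding w_eq z .
  have P2: "(deriv ^^ 2) P (1/2) = P (1/2) * (- 2 * \<kappa>\<^sup>2 * A)"
    and P4: "(deriv ^^ 4) P (1/2) = P (1/2) * (3 * (- 2 * \<kappa>\<^sup>2 * A)\<^sup>2 - 2 * \<kappa> ^ 4 * B)"
    using P_z0 unfolding w_eq AB z by simp_all
  have s2: "(\<Sum>i=0..2. h i) = h 0 + h 1 + h 2"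
    and s4: "(\<Sum>i=0..4. h i) = h 0 + h 1 + h 2 + h 3 + h 4" for h :: "nat \<Rightarrow> complex"
    by (simp_all add: eval_nat_numeral)
  have ch: "2 choose 2 = (1::nat)" "4 choose 2 = (6::nat)" "4 choose 4 = (1::nat)"
    by (simp_all add: eval_nat_numeral)
  have 0: "jacobi_theta (1/2) \<tau> = K"
    unfolding jacobi_theta_eq w_eq sd K_def by simp
  have "jacobi_theta_deriv 2 (1/2) \<tau> = 2 * exp (\<kappa> * \<tau> / 8) * ((deriv ^^ 2) P (1/2) - p\<^sup>2 * P (1/2))"
    unfolding D s2 sd by (simp add: ch)
  also have "\<dots> = K * (\<kappa>\<^sup>2 * (1 / 4 - 2 * A))"
    unfolding P2 w2 K_def by (simp add: power2_eq_square algebra_simps)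
  finally show "jacobi_theta_deriv 2 (1/2) \<tau> = jacobi_theta (1/2) \<tau> * (\<kappa>\<^sup>2 * (1 / 4 - 2 * A))"
    unfolding 0 .
  have "jacobi_theta_deriv 4 (1/2) \<tau> = 2 * exp (\<kappa> * \<tau> / 8) * ((deriv ^^ 4) P (1/2) - 6 * p\<^sup>2 * (deriv ^^ 2) P (1/2) + p ^ 4 * P (1/2))"
    unfolding D s4 sd by (simp add: ch)
  also have "\<dots> = K * (\<kappa> ^ 4 * (12 * A\<^sup>2 - 2 * B - 3 * A + 1 / 16))"
    unfolding P2 P4 w2 w4 K_def by (simp add: eval_nat_numeral algebra_simps)
  finally show "jacobi_theta_deriv 4 (1/2) \<tau> = jacobi_theta (1/2) \<tau> * (\<kappa> ^ 4 * (12 * A\<^sup>2 - 2 * B - 3 * A + 1 / 16))"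
    unfolding 0 .
  show "jacobi_theta (1/2) \<tau> \<noteq> 0" unfolding 0 by (rule K)
qed

theorem proposition1p1:
  fixes j k :: int and \<tau> q :: complex
  assumes "Im \<tau> > 0" and "q = q_param \<tau>"
  shows "theta_summand j k q summable_on UNIV \<and>
    (2 * of_real pi * \<i>) ^ 4 * (\<Sum>\<^sub>\<infinity>x\<in>UNIV. theta_summand j k q x) =
      (3 * jacobi_theta_deriv 2 (1/2) \<tau> / (2 * jacobi_theta (1/2) \<tau>)
        - jacobi_theta_deriv 3 0 \<tau> / (2 * jacobi_theta_deriv 1 0 \<tau>)) ^ 2
      + of_int (j ^ 2 + k ^ 2 - j * k) *
        ((jacobi_theta_deriv 2 (1/2) \<tau>) ^ 2 / (4 * (jacobi_theta (1/2) \<tau>) ^ 2)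
         + 5 * jacobi_theta_deriv 4 (1/2) \<tau> / (24 * jacobi_theta (1/2) \<tau>)
         - 7 * jacobi_theta_deriv 3 0 \<tau> * jacobi_theta_deriv 2 (1/2) \<tau>
             / (12 * jacobi_theta_deriv 1 0 \<tau> * jacobi_theta (1/2) \<tau>)
         - jacobi_theta_deriv 5 0 \<tau> / (24 * jacobi_theta_deriv 1 0 \<tau>)
         + (jacobi_theta_deriv 3 0 \<tau>) ^ 2 / (6 * (jacobi_theta_deriv 1 0 \<tau>) ^ 2))"
proof -
  have "theta_point \<tau> 0 1" by unfold_locales (use assms in auto)
  from theta_point.nome_q[OF this] interpret nome q unfolding assms(2) .
  define w where "w = 2 * complex_of_real pi * \<i>"
  define N where "N = complex_of_int (j ^ 2 + k ^ 2 - j * k)"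
  note th0 = theta_at_0[OF assms(1), folded assms(2) w_def, unfolded sum_li1 sum_li3]
  note th1 = theta_at_half[OF assms(1), folded assms(2) w_def, unfolded sum_li1 sum_li3]
  define t0 t1 where "t0 = jacobi_theta (1/2) \<tau>" and "t1 = jacobi_theta_deriv 1 0 \<tau>"
  have nz: "t0 \<noteq> 0" "t1 \<noteq> 0" using th0(1) th1(1) by (simp_all add: t0_def t1_def)
  \<comment> \<open>The theta quotients of order 2, 4 at 1/2 and 3, 5 at 0, stripped of their powers
    of w.\<close>
  define x2 x4 x3 x5 where "x2 = 1 / 4 - 2 * (3 * se - so)"
    and "x4 = 12 * (3 * se - so)\<^sup>2 - 2 * (15 * he - ho) - 3 * (3 * se - so) + 1 / 16"
    and "x3 = 1 / 4 - 6 * (so + se)"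
    and "x5 = 60 * (so + se)\<^sup>2 - 10 * (ho + he) - 5 * (so + se) + 1 / 16"
  have d: "jacobi_theta_deriv 2 (1/2) \<tau> = t0 * (w\<^sup>2 * x2)" "jacobi_theta_deriv 4 (1/2) \<tau> = t0 * (w ^ 4 * x4)"
    "jacobi_theta_deriv 3 0 \<tau> = t1 * (w\<^sup>2 * x3)" "jacobi_theta_deriv 5 0 \<tau> = t1 * (w ^ 4 * x5)"
    using th0 th1 by (simp_all add: t0_def t1_def x2_def x3_def x4_def x5_def)
  have r: "3 * (t0 * (w\<^sup>2 * x2)) / (2 * t0) = w\<^sup>2 * (3 / 2 * x2)"
    "t1 * (w\<^sup>2 * x3) / (2 * t1) = w\<^sup>2 * (x3 / 2)"
    "(t0 * (w\<^sup>2 * x2)) ^ 2 / (4 * t0 ^ 2) = w ^ 4 * (x2\<^sup>2 / 4)"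
    "5 * (t0 * (w ^ 4 * x4)) / (24 * t0) = w ^ 4 * (5 / 24 * x4)"
    "7 * (t1 * (w\<^sup>2 * x3)) * (t0 * (w\<^sup>2 * x2)) / (12 * t1 * t0) = w ^ 4 * (7 / 12 * x3 * x2)"
    "t1 * (w ^ 4 * x5) / (24 * t1) = w ^ 4 * (x5 / 24)"
    "(t1 * (w\<^sup>2 * x3)) ^ 2 / (6 * t1 ^ 2) = w ^ 4 * (x3\<^sup>2 / 6)"
    using nz by (simp_all add: field_simps power2_eq_square power4_eq_xxxx)
  have bracket: "x2\<^sup>2 / 4 + 5 / 24 * x4 - 7 / 12 * x3 * x2 - x5 / 24 + x3\<^sup>2 / 6 = E"
  proof -
    \<comment> \<open>As polynomials in the four Lambert sums the two sides differ; the difference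
      is 7/6 times the quadratic relation.\<close>
    have "x2\<^sup>2 / 4 + 5 / 24 * x4 - 7 / 12 * x3 * x2 - x5 / 24 + x3\<^sup>2 / 6 - 2 * ho =
        7 / 6 * ((12 * (so - se)\<^sup>2 + (so - se)) - (ho + 5 * he))"
      unfolding x2_def x3_def x4_def x5_def by (simp add: power2_eq_square field_simps)
    also have "\<dots> = 0" unfolding so_se_ho_he by simp
    finally show ?thesis unfolding E_eq ho_def[symmetric] by simp
  qed
  \<comment> \<open>In contrast to the bracket this is a linear identity: both sides are 1/4 + 6 (so
    - se).\<close>
  have C: "\<beta> + \<gamma> = 3 / 2 * x2 - x3 / 2"
    unfolding \<beta>_eq \<gamma>_eq so_def[symmetric] x2_def x3_def by (simp add: field_simps)
  have "(3 * jacobi_theta_deriv 2 (1/2) \<tau> / (2 * jacobi_theta (1/2) \<tau>)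
        - jacobi_theta_deriv 3 0 \<tau> / (2 * jacobi_theta_deriv 1 0 \<tau>)) ^ 2
      + of_int (j ^ 2 + k ^ 2 - j * k) *
        ((jacobi_theta_deriv 2 (1/2) \<tau>) ^ 2 / (4 * (jacobi_theta (1/2) \<tau>) ^ 2)
         + 5 * jacobi_theta_deriv 4 (1/2) \<tau> / (24 * jacobi_theta (1/2) \<tau>)
         - 7 * jacobi_theta_deriv 3 0 \<tau> * jacobi_theta_deriv 2 (1/2) \<tau>
             / (12 * jacobi_theta_deriv 1 0 \<tau> * jacobi_theta (1/2) \<tau>)
         - jacobi_theta_deriv 5 0 \<tau> / (24 * jacobi_theta_deriv 1 0 \<tau>)
         + (jacobi_theta_deriv 3 0 \<tau>) ^ 2 / (6 * (jacobi_theta_deriv 1 0 \<tau>) ^ 2)) =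
      (w\<^sup>2 * (3 / 2 * x2) - w\<^sup>2 * (x3 / 2))\<^sup>2 + N * (w ^ 4 * (x2\<^sup>2 / 4) + w ^ 4 * (5 / 24 * x4)
        - w ^ 4 * (7 / 12 * x3 * x2) - w ^ 4 * (x5 / 24) + w ^ 4 * (x3\<^sup>2 / 6))"
    unfolding N_def[symmetric] d t0_def[symmetric] t1_def[symmetric] r ..
  also have "\<dots> = w ^ 4 * ((3 / 2 * x2 - x3 / 2)\<^sup>2 + N * (x2\<^sup>2 / 4 + 5 / 24 * x4 - 7 / 12 * x3 * x2 - x5 / 24 + x3\<^sup>2 / 6))"
    by (simp add: power2_eq_square power4_eq_xxxx algebra_simps)
  also have "\<dots> = w ^ 4 * (\<Sum>\<^sub>\<infinity>x\<in>UNIV. theta_summand j k q x)"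
    unfolding infsumI[OF has_sum_theta_summand] C bracket N_def ..
  finally show ?thesis
    using has_sum_imp_summable[OF has_sum_theta_summand] unfolding w_def by metis
qed

end
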